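(* Let $\rho>1$, let $f$ be analytic inside and on the Bernstein ellipse $\mathcal{E}_\rho$, let $M=\max_{z\in\mathcal{E}_\rho}|f(z)|$ and let $L(\mathcal{E}_\rho)$ be the length of $\mathcal{E}_\rho$. Let $N\ge0$ be an integer, $f_N(x)=\sum_{n=0}^{N-1}a_n^\lambda C_n^{(\lambda)}(x)$, and suppose $\lambda>1$ and $\rho>\frac{(N+2\lambda)(N+\lambda+1)}{(N+\lambda)(N+1)}$. Then for all $x\in[-1,1]$, \[ |f(x)-f_N(x)|\le\frac{\Gamma(\lambda)\Gamma(N+2\lambda)}{\Gamma(2\lambda)\Gamma(N+\lambda)}\left(1+\frac{1}{\rho^2}\right)^{\lambda-1}\frac{C}{\rho^N}, \] where \[ C=\frac{ML(\mathcal{E}_\rho)}{\pi}\cdot\frac{(N+\lambda)(N+1)}{\rho(N+\lambda)(N+1)-(N+2\lambda)(N+\lambda+1)}. \]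
   Context: $C_n^{(\lambda)}$ is the Gegenbauer polynomial normalized by $C_n^{(\lambda)}(1)=\Gamma(n+2\lambda)/(n!\,\Gamma(2\lambda))$, orthogonal on $[-1,1]$ with weight $(1-x^2)^{\lambda-1/2}$, with $h_n^{(\lambda)}=\frac{2^{1-2\lambda}\pi}{\Gamma(\lambda)^2}\frac{\Gamma(n+2\lambda)}{\Gamma(n+1)(n+\lambda)}$ its squared weighted norm; the Gegenbauer coefficients of $f$ are $a_n^{\lambda}=\frac{1}{h_n^{(\lambda)}}\int_{-1}^1(1-x^2)^{\lambda-1/2}f(x)C_n^{(\lambda)}(x)\,dx$. $\mathcal{E}_\rho=\{\tfrac12(\rho e^{i\theta}+\rho^{-1}e^{-i\theta}):0\le\theta\le2\pi\}$. *)

theory Defs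
  imports "HOL-Analysis.Analysis"
begin

text \<open>Gegenbauer polynomials via the standard three-term recurrence
  C_0 = 1, C_1 = 2 lambda x, (n+1) C_(n+1) = 2 (n+lambda) x C_n - (n + 2 lambda - 1) C_(n-1);
  this gives the normalisation C_n(1) = Gamma(n+2 lambda)/(n! Gamma(2 lambda)).\<close>
fun gegenbauer :: "real \<Rightarrow> nat \<Rightarrow> real \<Rightarrow> real" where
  "gegenbauer l 0 x = 1"
| "gegenbauer l (Suc 0) x = 2 * l * x"
| "gegenbauer l (Suc (Suc n)) x =
     (2 * (real (Suc n) + l) * x * gegenbauer l (Suc n) x
      - (real (Suc n) + 2 * l - 1) * gegenbauer l n x) / real (Suc (Suc n))"

text \<open>Squared weighted norm h_n^(lambda).\<close>
definition gegenbauer_h :: "real \<Rightarrow> nat \<Rightarrow> real" where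
  "gegenbauer_h l n =
     2 powr (1 - 2 * l) * pi / (Gamma l)\<^sup>2 * Gamma (real n + 2 * l) / (Gamma (real n + 1) * (real n + l))"

definition gegenbauer_coeff :: "real \<Rightarrow> (complex \<Rightarrow> complex) \<Rightarrow> nat \<Rightarrow> complex" where
  "gegenbauer_coeff l f n =
     integral {-1..1} (\<lambda>x::real. complex_of_real ((1 - x\<^sup>2) powr (l - 1/2) * gegenbauer l n x) * f (complex_of_real x))
     / complex_of_real (gegenbauer_h l n)"

definition gegenbauer_partial :: "real \<Rightarrow> (complex \<Rightarrow> complex) \<Rightarrow> nat \<Rightarrow> real \<Rightarrow> complex" where
  "gegenbauer_partial l f N x = (\<Sum>n<N. gegenbauer_coeff l f n * complex_of_real (gegenbauer l n x))"

definition bernstein_param :: "real \<Rightarrow> real \<Rightarrow> complex" where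
  "bernstein_param \<rho> \<theta> = (complex_of_real \<rho> * cis \<theta> + cis (- \<theta>) / complex_of_real \<rho>) / 2"

definition bernstein_ellipse :: "real \<Rightarrow> complex set" where
  "bernstein_ellipse \<rho> = bernstein_param \<rho> ` {0..2*pi}"

text \<open>Closed region bounded by E_rho (inside and on): the filled ellipse with foci -1, 1
  and semi-major axis (rho + 1/rho)/2.\<close>
definition bernstein_region :: "real \<Rightarrow> complex set" where
  "bernstein_region \<rho> = {z. cmod (z - 1) + cmod (z + 1) \<le> \<rho> + 1 / \<rho>}"

text \<open>Arc length of E_rho: integral of |d/dtheta bernstein_param rho theta| over [0, 2 pi].\<close>
definition bernstein_length :: "real \<Rightarrow> real" where
  "bernstein_length \<rho> =
     integral {0..2*pi} (\<lambda>\<theta>. cmod (complex_of_real \<rho> * cis \<theta> - cis (- \<theta>) / complex_of_real \<rho>) / 2)"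

end

theory Submission
  imports Defs "HOL-Complex_Analysis.Complex_Analysis" "HOL-Real_Asymp.Real_Asymp"
begin

text \<open>For \<open>z = (u + 1 / u) / 2\<close> with \<open>cmod u > 1\<close>, the Cauchy kernel expands as
  \<open>1 / (z - x) = (\<Sum>n. (n + l) * k n * C_n x)\<close>, where \<open>k n\<close> is \<open>2 / u ^ (n + 1)\<close> times the Euler integral
  of \<open>t ^ n * ((1 - t) * (1 - t / u\<^sup>2)) powr (l - 1)\<close> over \<open>[0, 1]\<close>: integration by parts shows that \<open>k\<close>
  obeys the three-term recurrence of \<open>C\<close> up to a source term at \<open>n = 0\<close>, so \<open>z - x\<close> times a partial sum
  telescopes. Inserting the expansion into Cauchy's formula on the ellipse and using
  orthogonality identifies the Gegenbauer coefficients as contour integrals of \<open>f\<close> against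
  \<open>(n + l) * k n\<close>. As \<open>cmod (1 - t / u\<^sup>2) \<le> 1 + 1 / \<rho>\<^sup>2\<close>, they are bounded through a Beta integral, and with
  \<open>\<bar>C_n x\<bar> \<le> C_n 1\<close> the tail is dominated by a geometric series.\<close>

section \<open>Gegenbauer polynomials\<close>

text \<open>Two estimates of different quality are used. Identifying the coefficients needs uniform
  convergence on \<open>[-1,1]\<close> at any rate, so the remainder is bounded crudely, by Beta
  values at most 1 and the distance from the ellipse to the interval. The explicit constants come
  from the coefficient bound: the contour integral contributes \<open>M * L / (2 * pi)\<close> and
  the kernel a factor 2, while \<open>(n + l) * Beta (n + 1) l\<close> equals
  \<open>fact n * Gamma l / Gamma (n + l)\<close>, whose factorial cancels against that in
  \<open>C_n 1\<close>. What is left is proportional to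
  \<open>Gamma (n + 2 * l) / Gamma (n + l) / \<rho> ^ (n + 1)\<close>. Its ratio of consecutive
  terms, \<open>(n + 2 * l) / (n + l) / \<rho>\<close>, decreases in \<open>n\<close>, and the lower
  bound on \<open>\<rho>\<close> puts it below 1 from \<open>N\<close> on. The assumption
  \<open>l > 1\<close> makes the exponent \<open>l - 1\<close> positive, so that enlarging
  \<open>cmod (1 - t / u\<^sup>2)\<close> enlarges its power. Up to normalisation \<open>k n\<close>
  is the Gegenbauer function of the second kind, the Cauchy transform of the weight times
  \<open>C_n\<close>.\<close>

lemma gegenbauer_rec:
  "(real n + 2) * gegenbauer l (Suc (Suc n)) x
    = 2 * (real n + 1 + l) * x * gegenbauer l (Suc n) x - (real n + 2 * l) * gegenbauer l n x"
proof -
  have "real n + 2 \<noteq> 0" by linarith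
  then show ?thesis by (simp add: field_simps)
qed

lemma continuous_on_gegenbauer [continuous_intros]:
  assumes "continuous_on S g"
  shows "continuous_on S (\<lambda>x. gegenbauer l n (g x))"
  by (induction l n "0::real" rule: gegenbauer.induct) (auto intro!: continuous_intros assms)

text \<open>The factor \<open>1 - x\<^sup>2\<close> keeps the derivative in the family with the same
  \<open>l\<close>, whereas the usual formula moves to \<open>l + 1\<close>. Differentiating the
  recurrence and multiplying by \<open>1 - x\<^sup>2\<close> leaves a polynomial identity that
  follows from the recurrence at \<open>n\<close> and \<open>n + 1\<close>.\<close>

lemma has_real_derivative_gegenbauer:
  assumes "x\<^sup>2 \<noteq> 1"
  shows "(gegenbauer l n has_real_derivative
           ((real n + 2 * l) * x * gegenbauer l n x - (real n + 1) * gegenbauer l (Suc n) x) / (1 - x\<^sup>2)) (at x)"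
  using assms
proof (induction l n x rule: gegenbauer.induct)
  case (1 l x)
  then show ?case by (auto intro!: derivative_eq_intros)
next
  case (2 l x)
  then have "1 - x\<^sup>2 \<noteq> 0" by simp
  have "((\<lambda>x. 2 * l * x) has_real_derivative 2 * l) (at x)"
    by (auto intro!: derivative_eq_intros)
  moreover have "((real (Suc 0) + 2 * l) * x * gegenbauer l (Suc 0) x - (real (Suc 0) + 1) * gegenbauer l (Suc (Suc 0)) x)
      = 2 * l * (1 - x\<^sup>2)"
    by (simp add: power2_eq_square field_simps)
  ultimately show ?case using \<open>1 - x\<^sup>2 \<noteq> 0\<close> by (simp del: gegenbauer.simps(3))
next
  case (3 l n x)
  define a b c d where abcd: "a = gegenbauer l n x" "b = gegenbauer l (Suc n) x"
    "c = gegenbauer l (Suc (Suc n)) x" "d = gegenbauer l (Suc (Suc (Suc n))) x"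
  have nz: "1 - x\<^sup>2 \<noteq> 0" "real n + 2 \<noteq> 0" using 3 by (simp, linarith)
  define A B where AB: "A = ((real n + 2 * l) * x * a - (real n + 1) * b) / (1 - x\<^sup>2)"
     "B = ((real n + 1 + 2 * l) * x * b - (real n + 2) * c) / (1 - x\<^sup>2)"
  have dA: "(gegenbauer l n has_real_derivative A) (at x)"
    using 3 by (simp add: abcd AB del: gegenbauer.simps)
  have dB: "(gegenbauer l (Suc n) has_real_derivative B) (at x)"
    using 3 by (simp add: abcd AB add_ac del: gegenbauer.simps)
  have eq: "gegenbauer l (Suc (Suc n)) = (\<lambda>x. (2 * (real n + 1 + l) * x * gegenbauer l (Suc n) x
      - (real n + 2 * l) * gegenbauer l n x) / (real n + 2))"
    using nz gegenbauer_rec[of n l] by (simp only: fun_eq_iff nonzero_eq_divide_eq mult.commute simp_thms)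
  have "(gegenbauer l (Suc (Suc n)) has_real_derivative
      (2 * (real n + 1 + l) * (b + x * B) - (real n + 2 * l) * A) / (real n + 2)) (at x)"
    unfolding eq abcd
    by (rule DERIV_cdivide) (rule derivative_eq_intros dA dB refl | simp add: algebra_simps del: gegenbauer.simps)+
  moreover have "(2 * (real n + 1 + l) * (b + x * B) - (real n + 2 * l) * A) / (real n + 2)
     = ((real n + 2 + 2 * l) * x * c - (real n + 3) * d) / (1 - x\<^sup>2)"
  proof -
    have r1: "(real n + 2) * c = 2 * (real n + 1 + l) * x * b - (real n + 2 * l) * a"
      unfolding abcd by (rule gegenbauer_rec)
    have r2: "(real n + 3) * d = 2 * (real n + 2 + l) * x * c - (real n + 1 + 2 * l) * b"
      using gegenbauer_rec[of "Suc n" l x] unfolding abcd by (simp del: gegenbauer.simps add: add_ac)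
    have AB': "A * (1 - x\<^sup>2) = (real n + 2 * l) * x * a - (real n + 1) * b"
      "B * (1 - x\<^sup>2) = (real n + 1 + 2 * l) * x * b - (real n + 2) * c"
      using nz by (simp_all add: AB)
    have "(2 * (real n + 1 + l) * (b + x * B) - (real n + 2 * l) * A) * (1 - x\<^sup>2)
       = ((real n + 2 + 2 * l) * x * c - (real n + 3) * d) * (real n + 2)"
      using r1 r2 AB' by algebra
    then show ?thesis using nz by (simp add: frac_eq_eq)
  qed
  ultimately show ?case by (simp add: abcd add_ac del: gegenbauer.simps)
qed

section \<open>Orthogonality\<close>

definition gegenbauer_inner :: "real \<Rightarrow> nat \<Rightarrow> nat \<Rightarrow> real" where
  "gegenbauer_inner l m n = integral {-1..1} (\<lambda>x. (1 - x\<^sup>2) powr (l - 1/2) * gegenbauer l m x * gegenbauer l n x)"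

lemma square_le_1_Icc: "x \<in> {-1..1::real} \<Longrightarrow> x\<^sup>2 \<le> 1"
  by (simp add: abs_square_le_1 abs_le_iff)

lemma continuous_on_gegenbauer_weight [continuous_intros]:
  assumes "l > 1/2"
  shows "continuous_on {-1..1} (\<lambda>x::real. (1 - x\<^sup>2) powr (l - 1/2))"
  using assms by (intro continuous_on_powr' continuous_intros) (auto simp: square_le_1_Icc)

text \<open>The integrand times \<open>- n (n + 2 l)\<close> is the derivative of
  \<open>(1 - x\<^sup>2) powr (l + 1/2) * C_n'\<close>, by the Gegenbauer differential equation.\<close>
lemma gegenbauer_weighted_integral_0:
  assumes l: "l > 1/2" and n: "n > 0"
  shows "integral {-1..1} (\<lambda>x. (1 - x\<^sup>2) powr (l - 1/2) * gegenbauer l n x) = 0"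
proof -
  \<comment> \<open>\<open>F\<close> is \<open>1 - x\<^sup>2\<close> times the derivative of
    \<open>gegenbauer l n\<close>, written as a polynomial, so \<open>W * F\<close> needs no
    division and is continuous up to the endpoints.\<close>
  define F where "F = (\<lambda>x. (real n + 2 * l) * x * gegenbauer l n x - (real n + 1) * gegenbauer l (Suc n) x)"
  define W where "W = (\<lambda>x::real. (1 - x\<^sup>2) powr (l - 1/2))"
  have "((\<lambda>x. - (real n * (real n + 2 * l)) * (W x * gegenbauer l n x)) has_integral
      W 1 * F 1 - W (-1) * F (-1)) {-1..1}"
  proof (rule fundamental_theorem_of_calculus_interior)
    show "continuous_on {-1..1} (\<lambda>x. W x * F x)"
      unfolding W_def F_def by (intro continuous_intros l)
  next
    fix x :: real assume x: "x \<in> {-1<..<1}"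
    then have pos: "1 - x\<^sup>2 > 0" by (simp add: abs_square_less_1 abs_less_iff)
    then have x2: "x\<^sup>2 \<noteq> 1" by simp
    define a b where ab: "a = gegenbauer l n x" "b = gegenbauer l (Suc n) x"
    define c where c: "c = gegenbauer l (Suc (Suc n)) x"
    define A B where AB: "A = F x / (1 - x\<^sup>2)"
       "B = ((real n + 1 + 2 * l) * x * b - (real n + 2) * c) / (1 - x\<^sup>2)"
    have dA: "(gegenbauer l n has_real_derivative A) (at x)"
      using has_real_derivative_gegenbauer[OF x2] by (simp add: AB F_def)
    have dB: "(gegenbauer l (Suc n) has_real_derivative B) (at x)"
      using has_real_derivative_gegenbauer[OF x2, of l "Suc n"] by (simp add: AB ab c add_ac del: gegenbauer.simps)
    have dF: "(F has_real_derivative (real n + 2 * l) * (a + x * A) - (real n + 1) * B) (at x)"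
      unfolding F_def ab
      by (rule derivative_eq_intros dA dB refl | simp add: algebra_simps del: gegenbauer.simps)+
    have dW: "(W has_real_derivative (l - 1/2) * (- (2 * x)) * W x / (1 - x\<^sup>2)) (at x)"
    proof -
      have "(W has_real_derivative (l - 1/2) * (1 - x\<^sup>2) powr (l - 1/2 - 1) * (- (2 * x))) (at x)"
        unfolding W_def using pos by (auto intro!: derivative_eq_intros DERIV_fun_powr)
      moreover have "(1 - x\<^sup>2) powr (l - 1/2 - 1) = W x / (1 - x\<^sup>2)"
        unfolding W_def using pos by (subst powr_diff) simp
      ultimately show ?thesis by (simp add: mult_ac)
    qed
    have r1: "(real n + 2) * c = 2 * (real n + 1 + l) * x * b - (real n + 2 * l) * a"
      unfolding ab c by (rule gegenbauer_rec)
    have AB': "A * (1 - x\<^sup>2) = (real n + 2 * l) * x * a - (real n + 1) * b"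
      "B * (1 - x\<^sup>2) = (real n + 1 + 2 * l) * x * b - (real n + 2) * c"
      using x2 by (simp_all add: AB F_def ab)
    have "(l - 1/2) * (- (2 * x)) * A + ((real n + 2 * l) * (a + x * A) - (real n + 1) * B)
        = - (real n * (real n + 2 * l)) * a"
    proof -
      have "((l - 1/2) * (- (2 * x)) * A + ((real n + 2 * l) * (a + x * A) - (real n + 1) * B)) * (1 - x\<^sup>2)
        = (- (real n * (real n + 2 * l)) * a) * (1 - x\<^sup>2)"
        using r1 AB' by algebra
      moreover have "1 - x\<^sup>2 \<noteq> 0" using pos by simp
      ultimately show ?thesis by (metis mult_cancel_right)
    qed
    moreover have "(l - 1/2) * (- (2 * x)) * W x / (1 - x\<^sup>2) * F x + W x * ((real n + 2 * l) * (a + x * A) - (real n + 1) * B)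
      = W x * ((l - 1/2) * (- (2 * x)) * A + ((real n + 2 * l) * (a + x * A) - (real n + 1) * B))"
      using pos by (simp add: AB field_simps)
    ultimately have "(l - 1/2) * (- (2 * x)) * W x / (1 - x\<^sup>2) * F x + W x * ((real n + 2 * l) * (a + x * A) - (real n + 1) * B)
      = - (real n * (real n + 2 * l)) * (W x * a)"
      by simp
    then show "((\<lambda>x. W x * F x) has_vector_derivative - (real n * (real n + 2 * l)) * (W x * gegenbauer l n x)) (at x)"
      using DERIV_mult[OF dW dF]
      by (simp add: has_real_derivative_iff_has_vector_derivative ab mult_ac add_ac)
  qed simp
  \<comment> \<open>\<open>W\<close> vanishes at both endpoints because
    \<open>0 powr a = 0\<close>.\<close>
  from integral_unique[OF this]
  have "integral {-1..1} (\<lambda>x. - (real n * (real n + 2 * l)) * (W x * gegenbauer l n x)) = 0"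
    unfolding W_def by simp
  then have "- (real n * (real n + 2 * l)) * integral {-1..1} (\<lambda>x. W x * gegenbauer l n x) = 0"
    by (simp only: integral_mult_right)
  moreover have "real n * (real n + 2 * l) \<noteq> 0" using l n by (simp add: add_nonneg_eq_0_iff)
  ultimately show ?thesis by (simp add: W_def)
qed

lemma gegenbauer_inner_commute: "gegenbauer_inner l m n = gegenbauer_inner l n m"
  by (simp add: gegenbauer_inner_def mult_ac)

text \<open>\<open>X\<close> pairs \<open>x * C_m\<close> with \<open>C_n\<close>. Its symmetry lets
  the factor \<open>x\<close> pass from one polynomial to the other, whose recurrence can then
  absorb it.\<close>

lemma gegenbauer_inner_rec:
  assumes l: "l > 1/2"
  defines "X \<equiv> \<lambda>m n. integral {-1..1} (\<lambda>x. (1 - x\<^sup>2) powr (l - 1/2) * x * gegenbauer l m x * gegenbauer l n x)"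
  shows "2 * (real m + 1 + l) * X (Suc m) n
           = (real m + 2) * gegenbauer_inner l (Suc (Suc m)) n + (real m + 2 * l) * gegenbauer_inner l m n"
    and "2 * l * X 0 n = gegenbauer_inner l (Suc 0) n"
    and "X m n = X n m"
proof -
  let ?w = "\<lambda>x::real. (1 - x\<^sup>2) powr (l - 1/2)"
  have int: "(\<lambda>x. ?w x * gegenbauer l k x * gegenbauer l n x) integrable_on {-1..1}" for k
    by (intro integrable_continuous_real continuous_intros l)
  have "2 * (real m + 1 + l) * X (Suc m) n = integral {-1..1}
     (\<lambda>x. 2 * (real m + 1 + l) * (?w x * x * gegenbauer l (Suc m) x * gegenbauer l n x))"
    by (simp add: X_def del: gegenbauer.simps)
  also have "\<dots> = integral {-1..1}
     (\<lambda>x. (real m + 2) * (?w x * gegenbauer l (Suc (Suc m)) x * gegenbauer l n x)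
       + (real m + 2 * l) * (?w x * gegenbauer l m x * gegenbauer l n x))"
  proof (rule integral_cong)
    fix x :: real
    have "2 * (real m + 1 + l) * x * gegenbauer l (Suc m) x
      = (real m + 2) * gegenbauer l (Suc (Suc m)) x + (real m + 2 * l) * gegenbauer l m x"
      using gegenbauer_rec[of m l x] by simp
    then show "2 * (real m + 1 + l) * (?w x * x * gegenbauer l (Suc m) x * gegenbauer l n x)
      = (real m + 2) * (?w x * gegenbauer l (Suc (Suc m)) x * gegenbauer l n x)
       + (real m + 2 * l) * (?w x * gegenbauer l m x * gegenbauer l n x)"
      by algebra
  qed
  also have "\<dots> = (real m + 2) * gegenbauer_inner l (Suc (Suc m)) n + (real m + 2 * l) * gegenbauer_inner l m n"
    unfolding gegenbauer_inner_def
    by (subst Henstock_Kurzweil_Integration.integral_add)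
       (auto intro!: integrable_on_mult_right int simp del: gegenbauer.simps)
  finally show "2 * (real m + 1 + l) * X (Suc m) n
           = (real m + 2) * gegenbauer_inner l (Suc (Suc m)) n + (real m + 2 * l) * gegenbauer_inner l m n" .
  show "2 * l * X 0 n = gegenbauer_inner l (Suc 0) n"
    unfolding X_def gegenbauer_inner_def by (subst integral_mult_right [symmetric]) (simp add: mult_ac)
  show "X m n = X n m" by (simp add: X_def mult_ac)
qed

text \<open>The constant polynomial is the base case. To go up, the pairing of
  \<open>x * C_(m+1)\<close> with \<open>C_n\<close> is computed twice: the recurrence in the index
  \<open>n\<close> shows that it vanishes by induction, since \<open>n - 1 > m + 1\<close>; the
  recurrence in \<open>m\<close> then isolates the inner product sought. Hence \<open>n\<close> must
  stay arbitrary.\<close>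

lemma gegenbauer_orthogonal_less:
  assumes l: "l > 1/2"
  shows "m < n \<Longrightarrow> gegenbauer_inner l m n = 0"
proof (induction m arbitrary: n rule: induct_nat_012)
  case 0
  then show ?case using gegenbauer_weighted_integral_0[OF l, of n]
    by (simp add: gegenbauer_inner_def mult_ac)
next
  case 1
  note aux = gegenbauer_inner_rec[OF l]
  obtain k where k: "n = Suc k" "k > 0" using 1 by (cases n) auto
  have "2 * (real k + 1 + l) * integral {-1..1} (\<lambda>x. (1 - x\<^sup>2) powr (l - 1/2) * x * gegenbauer l (Suc k) x * gegenbauer l 0 x)
     = (real k + 2) * gegenbauer_inner l 0 (Suc (Suc k)) + (real k + 2 * l) * gegenbauer_inner l 0 k"
    using aux(1)[of k 0] by (simp add: gegenbauer_inner_commute)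
  also have "\<dots> = 0" using gegenbauer_weighted_integral_0[OF l, of k] gegenbauer_weighted_integral_0[OF l, of "Suc (Suc k)"] k
    by (simp add: gegenbauer_inner_def mult_ac)
  finally have "integral {-1..1} (\<lambda>x. (1 - x\<^sup>2) powr (l - 1/2) * x * gegenbauer l (Suc k) x * gegenbauer l 0 x) = 0"
    using l by (simp add: add_nonneg_eq_0_iff del: gegenbauer.simps)
  then show ?case using aux(2)[of n] aux(3)[of 0 n] k by (simp del: gegenbauer.simps)
next
  case (ge2 m)
  note aux = gegenbauer_inner_rec[OF l]
  obtain k where k: "n = Suc k" "k > Suc m" using ge2 by (cases n) auto
  have "2 * (real k + 1 + l) * integral {-1..1} (\<lambda>x. (1 - x\<^sup>2) powr (l - 1/2) * x * gegenbauer l (Suc k) x * gegenbauer l (Suc m) x)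
     = (real k + 2) * gegenbauer_inner l (Suc m) (Suc (Suc k)) + (real k + 2 * l) * gegenbauer_inner l (Suc m) k"
    using aux(1)[of k "Suc m"] by (simp add: gegenbauer_inner_commute del: gegenbauer.simps)
  also have "\<dots> = 0" using ge2.IH k by simp
  finally have "integral {-1..1} (\<lambda>x. (1 - x\<^sup>2) powr (l - 1/2) * x * gegenbauer l (Suc k) x * gegenbauer l (Suc m) x) = 0"
    using l by (simp add: add_nonneg_eq_0_iff del: gegenbauer.simps)
  then have "(real m + 2) * gegenbauer_inner l (Suc (Suc m)) n = 0"
    using aux(1)[of m n] aux(3)[of "Suc m" n] k ge2.IH(1)[of n] by (simp del: gegenbauer.simps)
  then show ?case by (simp add: add_nonneg_eq_0_iff)
qed

section \<open>Squared norms\<close>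

lemma Gamma_legendre_duplication_real:
  assumes "l > 0"
  shows "Gamma l * Gamma (l + 1/2) = 2 powr (1 - 2 * l) * sqrt pi * Gamma (2 * l :: real)"
proof -
  have "complex_of_real l \<notin> \<int>\<^sub>\<le>\<^sub>0" "complex_of_real l + 1/2 \<notin> \<int>\<^sub>\<le>\<^sub>0"
    using assms by (auto elim!: nonpos_Ints_cases simp: complex_eq_iff)
  from Gamma_legendre_duplication[OF this]
  have "complex_of_real (Gamma l * Gamma (l + 1/2))
     = complex_of_real (exp ((1 - 2 * l) * ln 2) * sqrt pi * Gamma (2 * l))"
    by (simp add: Gamma_complex_of_real[symmetric] exp_of_real[symmetric])
  then have "Gamma l * Gamma (l + 1/2) = exp ((1 - 2 * l) * ln 2) * sqrt pi * Gamma (2 * l)"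
    unfolding of_real_eq_iff .
  then show ?thesis by (simp add: powr_def)
qed

lemma Gamma_plus1_pos: "x > 0 \<Longrightarrow> Gamma (x + 1) = x * Gamma (x::real)"
  using nonpos_Ints_nonpos[of x] by (intro Gamma_plus1) auto

text \<open>The substitution \<open>x = 2 * t - 1\<close> yields
  \<open>Beta (l + 1/2) (l + 1/2)\<close>, and the duplication formula removes the shifts by one
  half.\<close>

lemma gegenbauer_weight_integral:
  assumes l: "l > 1/2"
  shows "((\<lambda>x::real. (1 - x\<^sup>2) powr (l - 1/2)) has_integral gegenbauer_h l 0) {-1..1}"
proof -
  have "((\<lambda>t. t powr (l + 1/2 - 1) * (1 - t) powr (l + 1/2 - 1)) has_integral Beta (l + 1/2) (l + 1/2)) {0..1}"
    using l by (intro has_integral_Beta_real) auto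
  then have "((\<lambda>t. t powr (l + 1/2 - 1) * (1 - t) powr (l + 1/2 - 1)) has_integral Beta (l + 1/2) (l + 1/2)) (cbox 0 1)"
    by simp
  from has_integral_affinity'[OF this, of "1/2" "1/2"]
  have "((\<lambda>x. ((x + 1) / 2) powr (l - 1/2) * (1 - (x + 1) / 2) powr (l - 1/2)) has_integral 2 * Beta (l + 1/2) (l + 1/2)) {-1..1}"
    by (simp add: add_divide_distrib)
  then have "((\<lambda>x. 4 powr (l - 1/2) * (((x + 1) / 2) powr (l - 1/2) * (1 - (x + 1) / 2) powr (l - 1/2)))
      has_integral 4 powr (l - 1/2) * (2 * Beta (l + 1/2) (l + 1/2))) {-1..1}"
    by (rule has_integral_mult_right)
  also have "?this \<longleftrightarrow> ((\<lambda>x. (1 - x\<^sup>2) powr (l - 1/2))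
      has_integral 4 powr (l - 1/2) * (2 * Beta (l + 1/2) (l + 1/2))) {-1..1}"
  proof (rule has_integral_cong)
    fix x :: real assume "x \<in> {-1..1}"
    then have nonneg: "(x + 1) / 2 \<ge> 0" "1 - (x + 1) / 2 \<ge> 0" by (auto simp: field_simps)
    have "4 powr a * (u powr a * v powr a) = (4 * (u * v)) powr a" if "u \<ge> 0" "v \<ge> 0" for a u v :: real
      using that by (simp add: powr_mult)
    from this[OF nonneg] have "4 powr (l - 1/2) * (((x + 1) / 2) powr (l - 1/2) * (1 - (x + 1) / 2) powr (l - 1/2))
      = (4 * (((x + 1) / 2) * (1 - (x + 1) / 2))) powr (l - 1/2)" .
    also have "4 * (((x + 1) / 2) * (1 - (x + 1) / 2)) = 1 - x\<^sup>2"
      by (simp add: field_simps power2_eq_square)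
    finally show "4 powr (l - 1/2) * (((x + 1) / 2) powr (l - 1/2) * (1 - (x + 1) / 2) powr (l - 1/2))
       = (1 - x\<^sup>2) powr (l - 1/2)" .
  qed
  also have "4 powr (l - 1/2) * (2 * Beta (l + 1/2) (l + 1/2)) = gegenbauer_h l 0"
  proof -
    have pos: "Gamma l > 0" "Gamma (2 * l) > 0" "l > 0" using l by (auto intro: Gamma_real_pos)
    have half: "Gamma (l + 1/2) = 2 powr (1 - 2 * l) * sqrt pi * Gamma (2 * l) / Gamma l"
    proof -
      have "Gamma l \<noteq> 0" using pos(1) by (metis less_irrefl)
      then have "Gamma (l + 1/2) = Gamma l * Gamma (l + 1/2) / Gamma l"
        by (rule nonzero_mult_div_cancel_left [symmetric])
      then show ?thesis by (simp only: Gamma_legendre_duplication_real[OF \<open>l > 0\<close>])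
    qed
    have G: "Gamma (l + 1/2 + (l + 1/2)) = 2 * l * Gamma (2 * l)"
      using Gamma_plus1_pos[of "2 * l"] pos by (simp add: add_ac)
    have p: "4 powr (l - 1/2) = 2 powr (2 * l - 1)"
      using powr_powr[of 2 2 "l - 1/2"] by (simp add: algebra_simps)
    have q: "2 powr (2 * l - 1) * 2 powr (1 - 2 * l) = (1::real)"
      by (simp add: powr_add[symmetric])
    have "4 powr (l - 1/2) * (2 * Beta (l + 1/2) (l + 1/2))
       = (2 powr (2 * l - 1) * 2 powr (1 - 2 * l)) * 2 powr (1 - 2 * l) * pi * Gamma (2 * l) / ((Gamma l)\<^sup>2 * l)"
      unfolding Beta_def G half p using pos by (simp add: field_simps power2_eq_square)
    then show ?thesis unfolding q by (simp add: gegenbauer_h_def)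
  qed
  finally show ?thesis .
qed

lemma gegenbauer_h_Suc:
  assumes "l > 0"
  shows "gegenbauer_h l (Suc n) * ((real n + 1) * (real n + 1 + l)) = (real n + 2 * l) * (real n + l) * gegenbauer_h l n"
proof -
  have "Gamma (real (Suc n) + 2 * l) = (real n + 2 * l) * Gamma (real n + 2 * l)"
    using Gamma_plus1_pos[of "real n + 2 * l"] assms by (simp add: add_ac)
  moreover have "Gamma (real (Suc n) + 1) = (real n + 1) * Gamma (real n + 1)"
    using Gamma_plus1_pos[of "real n + 1"] by (simp add: add_ac)
  moreover have "Gamma (real n + 1) > 0" "Gamma l > 0" "real n + 1 + l > 0" "real n + l > 0"
    using assms by (auto intro!: Gamma_real_pos)
  ultimately show ?thesis
    unfolding gegenbauer_h_def by (simp add: divide_simps)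
qed

lemma gegenbauer_h_pos:
  assumes "l > 0"
  shows "gegenbauer_h l n > 0"
  unfolding gegenbauer_h_def using assms
  by (auto intro!: mult_pos_pos divide_pos_pos Gamma_real_pos add_nonneg_pos zero_less_power)

text \<open>The integral of the weight times \<open>x * C_n * C_(n+1)\<close> can be evaluated by
  the recurrence in either index; equating the two values gives the quotient of consecutive norms,
  which is that of \<open>gegenbauer_h\<close>.\<close>

lemma gegenbauer_norm:
  assumes l: "l > 1/2"
  shows "gegenbauer_inner l n n = gegenbauer_h l n"
proof (induction n)
  case 0
  show ?case using gegenbauer_weight_integral[OF l] by (simp add: gegenbauer_inner_def integral_unique)
next
  case (Suc n)
  note aux = gegenbauer_inner_rec[OF l]
  note less = gegenbauer_orthogonal_less[OF l]
  have "l > 0" using l by simp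
  define X where "X = integral {-1..1} (\<lambda>x. (1 - x\<^sup>2) powr (l - 1/2) * x * gegenbauer l n x * gegenbauer l (Suc n) x)"
  have 1: "2 * (real n + 1 + l) * X = (real n + 2 * l) * gegenbauer_h l n"
    using aux(1)[of n n] aux(3)[of n "Suc n"] less[of n "Suc (Suc n)"] Suc
    by (simp add: X_def gegenbauer_inner_commute del: gegenbauer.simps)
  have 2: "2 * (real n + l) * X = (real n + 1) * gegenbauer_inner l (Suc n) (Suc n)"
  \<comment> \<open>\<open>C_1 = 2 * l * x * C_0\<close> is not an instance of the three-term
    recurrence, so the index 0 is separate.\<close>
  proof (cases n)
    case 0
    then show ?thesis using aux(2)[of "Suc 0"] by (simp add: X_def)
  next
    case (Suc k)
    then show ?thesis using aux(1)[of k "Suc n"] less[of k "Suc n"]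
      by (simp add: X_def add_ac del: gegenbauer.simps)
  qed
  have "gegenbauer_inner l (Suc n) (Suc n) * ((real n + 1) * (real n + 1 + l))
      = gegenbauer_h l (Suc n) * ((real n + 1) * (real n + 1 + l))"
    using 1 2 gegenbauer_h_Suc[OF \<open>l > 0\<close>, of n] by algebra
  moreover have "(real n + 1) * (real n + 1 + l) \<noteq> 0" using l by (simp add: add_nonneg_eq_0_iff)
  ultimately show ?case by simp
qed

lemma gegenbauer_orthogonality:
  assumes "l > 1/2"
  shows "gegenbauer_inner l m n = (if m = n then gegenbauer_h l n else 0)"
  using gegenbauer_norm[OF assms] gegenbauer_orthogonal_less[OF assms, of m n] gegenbauer_orthogonal_less[OF assms, of n m]
  by (auto simp: gegenbauer_inner_commute neq_iff)

section \<open>Generating function and the maximum on the interval\<close>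

lemma pochhammer_div_fact_Suc:
  fixes c :: "'a::field_char_0"
  shows "of_nat (Suc n) * (pochhammer c (Suc n) / fact (Suc n)) = (c + of_nat n) * (pochhammer c n / fact n)"
  by (simp add: pochhammer_rec' field_simps del: of_nat_Suc)

text \<open>Coefficientwise version of \<open>(1 - 2 x t + t\<^sup>2) powr (-l) = (1 - a t) powr (-l) * (1 - b t) powr (-l)\<close>
  with \<open>x = (a + b) / 2\<close> and \<open>a b = 1\<close>.\<close>
lemma gegenbauer_eq_convolution:
  fixes a b :: complex
  assumes ab: "a * b = 1" and x: "a + b = 2 * of_real x"
  shows "complex_of_real (gegenbauer l n x)
    = (\<Sum>k\<le>n. of_real (pochhammer l k / fact k) * a ^ k * (of_real (pochhammer l (n - k) / fact (n - k)) * b ^ (n - k)))"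
proof -
  \<comment> \<open>\<open>P c\<close> is the binomial series of \<open>(1 - c t) powr (-l)\<close>;
    as a formal series it needs no branch of the power and is handled through its differential
    equation.\<close>
  define P where "P = (\<lambda>c. Abs_fps (\<lambda>k. pochhammer (complex_of_real l) k / fact k * c ^ k))"
  have P: "(1 - fps_const c * fps_X) * fps_deriv (P c) = fps_const (of_real l * c) * P c" for c
  proof (rule fps_ext)
    fix n
    have *: "of_nat (Suc m) * fps_nth (P c) (Suc m) = (of_real l + of_nat m) * c * fps_nth (P c) m" for m
    proof -
      have "of_nat (Suc m) * fps_nth (P c) (Suc m)
        = (of_nat (Suc m) * (pochhammer (complex_of_real l) (Suc m) / fact (Suc m))) * c ^ Suc m"
        by (simp only: P_def fps_nth_Abs_fps mult.assoc)
      then show ?thesis unfolding pochhammer_div_fact_Suc by (simp add: P_def)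
    qed
    show "fps_nth ((1 - fps_const c * fps_X) * fps_deriv (P c)) n = fps_nth (fps_const (of_real l * c) * P c) n"
      using *[of n] arg_cong[OF *[of "n - 1"], of "(*) c"] by (cases n) (simp_all add: algebra_simps)
  qed
  define G where "G = P a * P b"
  \<comment> \<open>With \<open>a * b = 1\<close> and \<open>a + b = 2 * x\<close> the equations for
    \<open>P a\<close> and \<open>P b\<close> combine to
    \<open>(1 - 2 x t + t^2) G' = 2 l (x - t) G\<close>; comparing coefficients gives the three-term
    recurrence.\<close>
  have G: "fps_deriv G - fps_const (2 * of_real x) * (fps_X * fps_deriv G) + fps_X * (fps_X * fps_deriv G)
      = fps_const (2 * of_real l * of_real x) * G - fps_const (2 * of_real l) * (fps_X * G)"
  proof -
    define A B L where "A = fps_const a" "B = fps_const b" "L = fps_const (complex_of_real l)"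
    note ABL = this
    have AB: "A * B = 1" "A + B = fps_const (2 * of_real x)" by (simp_all add: ABL ab x)
    have dP: "(1 - A * fps_X) * fps_deriv (P a) = L * A * P a" "(1 - B * fps_X) * fps_deriv (P b) = L * B * P b"
      using P[of a] P[of b] by (simp_all add: ABL)
    have dG: "fps_deriv G = fps_deriv (P a) * P b + P a * fps_deriv (P b)"
      by (simp add: G_def)
    have "fps_deriv G - (A + B) * (fps_X * fps_deriv G) + fps_X * (fps_X * fps_deriv G)
      = L * (A + B) * G - 2 * L * (fps_X * G)"
      using AB(1) dP dG G_def by algebra
    moreover have "L * (A + B) = fps_const (2 * of_real l * of_real x)" "2 * L = fps_const (2 * of_real l)"
      unfolding AB by (simp_all add: ABL numeral_fps_const)
    ultimately show ?thesis unfolding AB by simp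
  qed
  have G0: "fps_nth G 0 = 1" by (simp add: G_def P_def)
  have G1: "fps_nth G (Suc 0) = 2 * of_real l * of_real x"
    using arg_cong[OF G, of "\<lambda>f. fps_nth f 0"] G0 by simp
  have G2: "(of_nat n + 2) * fps_nth G (Suc (Suc n))
    = 2 * (of_nat n + 1 + of_real l) * of_real x * fps_nth G (Suc n)
      - (of_nat n + 2 * of_real l) * fps_nth G n" for n
    using arg_cong[OF G, of "\<lambda>f. fps_nth f (Suc n)"]
    by (cases n) (simp_all add: algebra_simps)
  have "fps_nth G n = complex_of_real (gegenbauer l n x)"
  proof (induction n rule: induct_nat_012)
    case (ge2 n)
    have nz: "complex_of_nat n + 2 \<noteq> 0"
      by (metis of_nat_Suc of_nat_eq_0_iff add_2_eq_Suc' of_nat_add of_nat_numeral nat.distinct(1))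
    have "(of_nat n + 2) * complex_of_real (gegenbauer l (Suc (Suc n)) x) =
      2 * (of_nat n + 1 + of_real l) * of_real x * complex_of_real (gegenbauer l (Suc n) x)
      - (of_nat n + 2 * of_real l) * complex_of_real (gegenbauer l n x)"
      using arg_cong[OF gegenbauer_rec[of n l x], of complex_of_real] by (simp del: gegenbauer.simps)
    with ge2 G2[of n] have "(of_nat n + 2) * fps_nth G (Suc (Suc n))
       = (of_nat n + 2) * complex_of_real (gegenbauer l (Suc (Suc n)) x)" by simp
    then show ?case using nz by (simp only: mult_cancel_left) simp
  qed (simp_all add: G0 G1)
  then show ?thesis by (simp add: G_def P_def fps_mult_nth atLeast0AtMost pochhammer_of_real)
qed

lemma gegenbauer_at_1_convolution:
  "gegenbauer l n 1 = (\<Sum>k\<le>n. pochhammer l k / fact k * (pochhammer l (n - k) / fact (n - k)))"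
proof -
  have "complex_of_real (gegenbauer l n 1)
    = of_real (\<Sum>k\<le>n. pochhammer l k / fact k * (pochhammer l (n - k) / fact (n - k)))"
    using gegenbauer_eq_convolution[of 1 1 1 l n] by simp
  then show ?thesis unfolding of_real_eq_iff .
qed

text \<open>For \<open>x = cos t\<close> the numbers \<open>a\<close>, \<open>b\<close> of the
  convolution formula are \<open>cis t\<close> and \<open>cis (- t)\<close>, of modulus 1, and its
  coefficients are nonnegative for \<open>l > 0\<close>; the triangle inequality therefore leads to
  the sum belonging to \<open>a = b = 1\<close>.\<close>

lemma abs_gegenbauer_le:
  assumes "l > 0" and x: "x \<in> {-1..1}"
  shows "\<bar>gegenbauer l n x\<bar> \<le> gegenbauer l n 1"
proof -
  define t where "t = arccos x"
  have x: "x = cos t" using x by (simp add: t_def)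
  have "cis t * cis (- t) = 1" "cis t + cis (- t) = 2 * complex_of_real x"
    by (simp_all add: cis_mult x complex_eq_iff)
  note eq = gegenbauer_eq_convolution[OF this, of l n]
  have "\<bar>gegenbauer l n x\<bar> = cmod (complex_of_real (gegenbauer l n x))" by simp
  also have "\<dots> \<le> (\<Sum>k\<le>n. cmod (of_real (pochhammer l k / fact k) * cis t ^ k
      * (of_real (pochhammer l (n - k) / fact (n - k)) * cis (- t) ^ (n - k))))"
    unfolding eq by (rule norm_sum)
  also have "\<dots> = (\<Sum>k\<le>n. pochhammer l k / fact k * (pochhammer l (n - k) / fact (n - k)))"
    using assms by (intro sum.cong refl)
      (simp add: norm_mult norm_power norm_divide pochhammer_nonneg)
  also have "\<dots> = gegenbauer l n 1" by (rule gegenbauer_at_1_convolution [symmetric])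
  finally show ?thesis .
qed

lemma gegenbauer_Suc_at_1: "(real n + 1) * gegenbauer l (Suc n) 1 = (real n + 2 * l) * gegenbauer l n 1"
proof (induction n)
  case (Suc n)
  then show ?case using gegenbauer_rec[of n l 1]
    by (simp add: algebra_simps del: gegenbauer.simps)
qed simp

lemma gegenbauer_at_1:
  assumes l: "l > 0"
  shows "gegenbauer l n 1 = Gamma (real n + 2 * l) / (fact n * Gamma (2 * l))"
proof -
  have "Gamma (2 * l) > 0" using l by (intro Gamma_real_pos) auto
  show ?thesis
  proof (induction n)
    case 0
    then show ?case using \<open>Gamma (2 * l) > 0\<close> by simp
  next
    case (Suc n)
    have "gegenbauer l (Suc n) 1 = (real n + 2 * l) * gegenbauer l n 1 / (real n + 1)"
      using gegenbauer_Suc_at_1[of n l] by (simp add: field_simps del: gegenbauer.simps)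
    also have "\<dots> = ((real n + 2 * l) * Gamma (real n + 2 * l)) / ((real n + 1) * fact n * Gamma (2 * l))"
      unfolding Suc.IH by (simp add: divide_simps)
    also have "(real n + 2 * l) * Gamma (real n + 2 * l) = Gamma (real (Suc n) + 2 * l)"
      using Gamma_plus1_pos[of "real n + 2 * l"] l by (simp add: add_ac)
    finally show ?case by (simp add: algebra_simps del: gegenbauer.simps)
  qed
qed

section \<open>Expansion of the Cauchy kernel\<close>

text \<open>Euler's integral for the hypergeometric function
  \<open>2F1(n + 1, 1 - l; n + l + 1; w)\<close>, without its normalising Beta factor.\<close>
definition euler_int :: "real \<Rightarrow> complex \<Rightarrow> nat \<Rightarrow> complex" where
  "euler_int l w n = integral {0..1}
     (\<lambda>t. of_real (t ^ n * (1 - t) powr (l - 1)) * (1 - of_real t * w) powr of_real (l - 1))"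

text \<open>Keeps the base of the complex power in the right half-plane, away from the branch cut,
  for all \<open>t\<close> up to and including 1.\<close>

lemma Re_one_minus_pos:
  assumes "t \<in> {0..1}" "cmod w < 1"
  shows "Re (1 - of_real t * w) > 0"
proof -
  have "Re (of_real t * w) \<le> cmod (of_real t * w)" by (rule complex_Re_le_cmod)
  also have "\<dots> \<le> 1 * cmod w" using assms by (auto simp: norm_mult intro!: mult_left_le_one_le)
  also have "\<dots> < 1" using assms by simp
  finally show ?thesis by simp
qed

lemma continuous_on_one_minus_powr:
  fixes g :: "'a::topological_space \<Rightarrow> real"
  assumes "r > 0" "continuous_on S g" "\<And>x. x \<in> S \<Longrightarrow> g x \<le> 1"
  shows "continuous_on S (\<lambda>x. (1 - g x) powr r)"
  using assms by (intro continuous_on_powr' continuous_intros) auto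

lemma continuous_on_one_minus_mult_powr:
  fixes f g :: "'a::topological_space \<Rightarrow> _"
  assumes "continuous_on S f" "continuous_on S g" "\<And>x. x \<in> S \<Longrightarrow> f x \<in> {0..1} \<and> cmod (g x) < 1"
  shows "continuous_on S (\<lambda>x. (1 - of_real (f x) * g x) powr of_real r)"
proof (intro continuous_on_powr_complex continuous_intros assms)
  have pos: "Re (1 - of_real (f x) * g x) > 0" if "x \<in> S" for x
    using assms(3)[OF that] by (intro Re_one_minus_pos) auto
  then show "S \<subseteq> {x. 0 \<le> Re (1 - of_real (f x) * g x) \<or> Im (1 - of_real (f x) * g x) \<noteq> 0}"
    by (force intro: less_imp_le)
  show "x \<in> S \<Longrightarrow> 1 - of_real (f x) * g x = 0 \<Longrightarrow> 0 < Re (of_real r)" for x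
    using pos[of x] by simp
qed

text \<open>Joint continuity serves both integrability in \<open>t\<close> and continuity of the
  integral in \<open>w\<close>.\<close>

lemma continuous_on_euler_integrand:
  assumes "l > 1"
  shows "continuous_on ({w. cmod w < 1} \<times> cbox 0 1)
    (\<lambda>(w, t). of_real (t ^ n * (1 - t) powr (l - 1)) * (1 - of_real t * w) powr of_real (l - 1))"
  unfolding case_prod_unfold using assms
  by (intro continuous_on_mult continuous_on_of_real continuous_on_one_minus_powr
       continuous_on_one_minus_mult_powr continuous_intros) auto

lemma euler_integrand_integrable:
  assumes "l > 1" "cmod w < 1"
  shows "(\<lambda>t. of_real (t ^ n * (1 - t) powr (l - 1)) * (1 - of_real t * w) powr of_real (l - 1)) integrable_on {0..1}"
proof (rule integrable_continuous_real)
  have "continuous_on {0..1} (\<lambda>t. (w, t))" by (intro continuous_intros)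
  from continuous_on_compose2[OF continuous_on_euler_integrand[OF assms(1), of n] this] assms(2)
  show "continuous_on {0..1} (\<lambda>t. of_real (t ^ n * (1 - t) powr (l - 1)) * (1 - of_real t * w) powr of_real (l - 1))"
    by auto
qed

lemma continuous_on_euler_int:
  assumes "l > 1"
  shows "continuous_on {w. cmod w < 1} (\<lambda>w. euler_int l w n)"
  using integral_continuous_on_param[OF continuous_on_euler_integrand[OF assms, of n]]
  by (simp add: euler_int_def)

text \<open>Integrate the derivative of \<open>t ^ n * ((1 - t) * (1 - t w)) powr l\<close> over \<open>[0, 1]\<close>.\<close>
lemma euler_int_rec:
  assumes l: "l > 1" and w: "cmod w < 1"
  shows "(1 + w) * (of_nat n + of_real l) * euler_int l w n
     = of_nat n * euler_int l w (n - 1) + (of_nat n + 2 * of_real l) * w * euler_int l w (Suc n)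
       + (if n = 0 then 1 else 0)"
proof -
  define p where "p = (\<lambda>t::real. (1 - t) powr (l - 1))"
  define q where "q = (\<lambda>t::real. (1 - of_real t * w) powr of_real (l - 1))"
  define F where "F = (\<lambda>t::real. of_real (t ^ n * (1 - t) powr l) * (1 - of_real t * w) powr of_real l)"
  define g where "g = (\<lambda>k (t::real). of_real (t ^ k * p t) * q t)"
  have int: "(g k has_integral euler_int l w k) {0..1}" for k
    unfolding g_def p_def q_def euler_int_def
    by (rule integrable_integral) (rule euler_integrand_integrable[OF l w])
  have "((\<lambda>t. of_nat n * g (n - 1) t - (1 + w) * (of_nat n + of_real l) * g n t
           + (of_nat n + 2 * of_real l) * w * g (Suc n) t) has_integral F 1 - F 0) {0..1}"
  proof (rule fundamental_theorem_of_calculus_interior)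
    show "continuous_on {0..1} F"
      unfolding F_def using l
      by (intro continuous_on_mult continuous_on_of_real continuous_on_one_minus_powr
           continuous_on_one_minus_mult_powr continuous_intros) (use w in auto)
  next
    fix t :: real assume t: "t \<in> {0<..<1}"
    define u where "u = 1 - complex_of_real t * w"
    have u: "u \<notin> \<real>\<^sub>\<le>\<^sub>0" using Re_one_minus_pos[of t w] t w by (auto simp: u_def complex_nonpos_Reals_iff)
    then have "u \<noteq> 0" by auto
    \<comment> \<open>Splitting one factor off each power leaves the common factors
      \<open>p t\<close> and \<open>q t\<close>, so that the derivative identity becomes purely
      algebraic.\<close>
    have ul: "u powr of_real l = u * q t"
    proof -
      have "u powr (1 + of_real (l - 1)) = u powr 1 * u powr of_real (l - 1)"
        by (rule powr_add)
      then show ?thesis by (simp add: q_def u_def)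
    qed
    have pl: "(1 - t) powr l = (1 - t) * p t"
      using t powr_add[of "1 - t" 1 "l - 1"] by (simp add: p_def)
    have "((\<lambda>t. t ^ n * (1 - t) powr l) has_real_derivative
        (real n * t ^ (n - 1) * (1 - t) powr l - t ^ n * (l * p t))) (at t)"
      unfolding p_def using t by (auto intro!: derivative_eq_intros DERIV_fun_powr)
    then have dA: "((\<lambda>t. complex_of_real (t ^ n * (1 - t) powr l)) has_vector_derivative
        of_real (real n * t ^ (n - 1) * (1 - t) powr l - t ^ n * (l * p t))) (at t)"
      by (intro has_vector_derivative_of_real) (simp add: has_real_derivative_iff_has_vector_derivative)
    have "((\<lambda>z. (1 - z * w) powr of_real l) has_field_derivative of_real l * u powr (of_real l - 1) * (- w)) (at (of_real t))"
      unfolding u_def using u[unfolded u_def]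
      by (auto intro!: derivative_eq_intros)
    then have dB: "((\<lambda>t. (1 - of_real t * w) powr of_real l) has_vector_derivative of_real l * q t * (- w)) (at t)"
      using has_vector_derivative_real_field by (fastforce simp: q_def u_def)
    \<comment> \<open>The truncated \<open>n - 1\<close> at \<open>n = 0\<close> is harmless, since
      the factor \<open>n\<close> is zero there.\<close>
    have pw: "of_nat n * of_real t ^ n = of_nat n * (of_real t :: complex) ^ (n - 1) * of_real t"
      by (cases n) auto
    have "of_real (t ^ n * (1 - t) powr l) * (of_real l * q t * (- w)) +
       of_real (real n * t ^ (n - 1) * (1 - t) powr l - t ^ n * (l * p t)) * (u powr of_real l)
      = of_nat n * g (n - 1) t - (1 + w) * (of_nat n + of_real l) * g n t
           + (of_nat n + 2 * of_real l) * w * g (Suc n) t"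
    proof -
      define T N L Q P T' where "T = complex_of_real t ^ n" "N = complex_of_nat n"
        "L = complex_of_real l" "Q = q t" "P = complex_of_real (p t)" "T' = complex_of_real t ^ (n - 1)"
      note TN = this
      define s where "s = complex_of_real t"
      have "T * ((1 - s) * P) * (L * Q * (- w)) + (N * T' * ((1 - s) * P) - T * (L * P)) * ((1 - s * w) * Q)
        = N * (T' * P * Q) - (1 + w) * (N + L) * (T * P * Q) + (N + 2 * L) * w * (s * T * P * Q)"
        using pw[folded TN s_def] by algebra
      then show ?thesis
        unfolding pl ul TN s_def by (simp add: g_def u_def)
    qed
    with has_vector_derivative_mult[OF dA dB]
    show "(F has_vector_derivative of_nat n * g (n - 1) t - (1 + w) * (of_nat n + of_real l) * g n t
           + (of_nat n + 2 * of_real l) * w * g (Suc n) t) (at t)"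
      by (simp add: F_def u_def)
  qed simp
  moreover have "((\<lambda>t. of_nat n * g (n - 1) t - (1 + w) * (of_nat n + of_real l) * g n t
           + (of_nat n + 2 * of_real l) * w * g (Suc n) t) has_integral
       of_nat n * euler_int l w (n - 1) - (1 + w) * (of_nat n + of_real l) * euler_int l w n
           + (of_nat n + 2 * of_real l) * w * euler_int l w (Suc n)) {0..1}"
    by (intro has_integral_add has_integral_diff has_integral_mult_right int)
  ultimately have "of_nat n * euler_int l w (n - 1) - (1 + w) * (of_nat n + of_real l) * euler_int l w n
           + (of_nat n + 2 * of_real l) * w * euler_int l w (Suc n) = F 1 - F 0"
    by (rule has_integral_unique[rotated])
  \<comment> \<open>The source term is the boundary value at 0, where \<open>0 ^ 0 = 1\<close>; at
    \<open>t = 1\<close> the factor \<open>0 powr l\<close> vanishes.\<close>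
  moreover have "F 1 - F 0 = - (if n = 0 then 1 else 0)" using l by (simp add: F_def)
  ultimately have "of_nat n * euler_int l w (n - 1) - (1 + w) * (of_nat n + of_real l) * euler_int l w n
           + (of_nat n + 2 * of_real l) * w * euler_int l w (Suc n) = - (if n = 0 then 1 else 0)"
    by (rule trans)
  then show ?thesis by algebra
qed

lemma norm_euler_int_le:
  assumes l: "l > 1" and w: "cmod w < 1"
  shows "cmod (euler_int l w n) \<le> (1 + cmod w) powr (l - 1) * Beta (real n + 1) l"
proof -
  have B: "((\<lambda>t. (1 + cmod w) powr (l - 1) * (t powr (real n + 1 - 1) * (1 - t) powr (l - 1))) has_integral
      (1 + cmod w) powr (l - 1) * Beta (real n + 1) l) {0..1}"
    using l by (intro has_integral_mult_right has_integral_Beta_real) auto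
  \<comment> \<open>For \<open>n = 0\<close> the integrands differ at \<open>t = 0\<close>, as
    \<open>0 powr 0 = 0\<close> but \<open>0 ^ 0 = 1\<close>.\<close>
  then have B': "((\<lambda>t. (1 + cmod w) powr (l - 1) * (t ^ n * (1 - t) powr (l - 1))) has_integral
      (1 + cmod w) powr (l - 1) * Beta (real n + 1) l) {0..1}"
    by (rule has_integral_spike_finite[rotated 2, where S = "{0}"]) (auto simp: powr_realpow)
  have "cmod (euler_int l w n)
    \<le> integral {0..1} (\<lambda>t. (1 + cmod w) powr (l - 1) * (t ^ n * (1 - t) powr (l - 1)))"
    unfolding euler_int_def
  proof (rule integral_norm_bound_integral)
    show "(\<lambda>t. (1 + cmod w) powr (l - 1) * (t ^ n * (1 - t) powr (l - 1))) integrable_on {0..1}"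
      using B' by blast
    fix t :: real assume t: "t \<in> {0..1}"
    have "cmod (1 - of_real t * w) \<le> 1 + cmod (of_real t * w)"
      by (metis norm_one norm_triangle_ineq4)
    also have "\<dots> \<le> 1 + cmod w" using t by (auto simp: norm_mult intro!: mult_left_le_one_le)
    finally have "cmod (1 - of_real t * w) powr (l - 1) \<le> (1 + cmod w) powr (l - 1)"
      using l by (intro powr_mono2) auto
    then show "cmod (of_real (t ^ n * (1 - t) powr (l - 1)) * (1 - of_real t * w) powr of_real (l - 1))
      \<le> (1 + cmod w) powr (l - 1) * (t ^ n * (1 - t) powr (l - 1))"
      using t mult_left_mono[of _ _ "t ^ n * (1 - t) powr (l - 1)"]
      by (simp add: norm_mult norm_powr_real_powr' norm_power mult.commute[of _ "t ^ n * (1 - t) powr (l - 1)"])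
  qed (rule euler_integrand_integrable[OF l w])
  also have "\<dots> = (1 + cmod w) powr (l - 1) * Beta (real n + 1) l"
    using B' by (rule integral_unique)
  finally show ?thesis .
qed

text \<open>The \<open>n\<close>-th Gegenbauer coefficient of \<open>1 / ((u + 1 / u) / 2 - x)\<close> as a function of \<open>x\<close> is
  \<open>n + l\<close> times this; the factor is split off to make the recurrence that of \<open>gegenbauer\<close>.\<close>
definition gegenbauer_kernel :: "real \<Rightarrow> complex \<Rightarrow> nat \<Rightarrow> complex" where
  "gegenbauer_kernel l u n = 2 * euler_int l (1 / u\<^sup>2) n / u ^ Suc n"

lemma norm_inverse_power2_less_1: "cmod u > 1 \<Longrightarrow> cmod (1 / u\<^sup>2) < 1"
  by (simp add: norm_divide norm_power divide_less_eq one_less_power)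

lemma continuous_on_gegenbauer_kernel:
  assumes "l > 1"
  shows "continuous_on {u. cmod u > 1} (\<lambda>u. gegenbauer_kernel l u n)"
proof -
  have "continuous_on {u. cmod u > 1} (\<lambda>u. euler_int l (1 / u\<^sup>2) n)"
    by (rule continuous_on_compose2[OF continuous_on_euler_int[OF assms]])
       (auto intro!: continuous_intros dest: norm_inverse_power2_less_1)
  then show ?thesis unfolding gegenbauer_kernel_def by (intro continuous_intros) auto
qed

text \<open>With \<open>w = 1 / u\<^sup>2\<close> one has \<open>2 * z = u * (1 + w)\<close>, and
  the power of \<open>u\<close> in the kernel absorbs the factor \<open>w\<close> of the Euler
  recurrence. The coefficients are transposed against those of \<open>gegenbauer\<close>:
  \<open>n\<close> and \<open>n + 2 * l\<close> stand at the neighbours \<open>n - 1\<close> and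
  \<open>n + 1\<close>, as summation by parts requires.\<close>

lemma gegenbauer_kernel_rec:
  assumes l: "l > 1" and u: "cmod u > 1" and z: "u + 1 / u = 2 * z"
  shows "2 * z * (of_nat n + of_real l) * gegenbauer_kernel l u n
     = of_nat n * gegenbauer_kernel l u (n - 1) + (of_nat n + 2 * of_real l) * gegenbauer_kernel l u (Suc n)
       + (if n = 0 then 2 else 0)"
proof -
  define w where "w = 1 / u\<^sup>2"
  have u0: "u \<noteq> 0" using u by auto
  have "cmod w < 1" unfolding w_def by (rule norm_inverse_power2_less_1[OF u])
  note rec = euler_int_rec[OF l this, of n]
  have 2: "2 * z = u * (1 + w)" using u0 unfolding z[symmetric] by (simp add: w_def field_simps power2_eq_square)
  have "2 * z * (of_nat n + of_real l) * gegenbauer_kernel l u n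
     = 2 / u ^ n * ((1 + w) * (of_nat n + of_real l) * euler_int l w n)"
    using u0 unfolding 2 gegenbauer_kernel_def w_def[symmetric] by simp
  also have "\<dots> = of_nat n * (2 * euler_int l w (n - 1) / u ^ n)
     + (of_nat n + 2 * of_real l) * (2 * euler_int l w (Suc n) * w / u ^ n) + (if n = 0 then 2 else 0)"
    unfolding rec by (simp add: algebra_simps add_divide_distrib)
  also have "2 * euler_int l w (Suc n) * w / u ^ n = gegenbauer_kernel l u (Suc n)"
    using u0 by (simp add: gegenbauer_kernel_def w_def field_simps power2_eq_square)
  also have "of_nat n * (2 * euler_int l w (n - 1) / u ^ n) = of_nat n * gegenbauer_kernel l u (n - 1)"
    by (cases n) (simp_all add: gegenbauer_kernel_def w_def)
  finally show ?thesis .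
qed

text \<open>A Christoffel--Darboux type telescoping sum: \<open>gegenbauer_kernel\<close> and \<open>gegenbauer\<close>
  satisfy the same three-term recurrence, up to the inhomogeneity at \<open>n = 0\<close>.\<close>
lemma gegenbauer_kernel_sum:
  fixes x :: real
  assumes l: "l > 1" and u: "cmod u > 1" and z: "u + 1 / u = 2 * z"
  shows "(z - of_real x) * (\<Sum>n\<le>m. (of_nat n + of_real l) * gegenbauer_kernel l u n * of_real (gegenbauer l n x))
    = 1 - ((of_nat m + 1) * gegenbauer_kernel l u m * of_real (gegenbauer l (Suc m) x)
         - (of_nat m + 2 * of_real l) * gegenbauer_kernel l u (Suc m) * of_real (gegenbauer l m x)) / 2"
proof (induction m)
  case 0
  show ?case using gegenbauer_kernel_rec[OF assms, of 0] by (simp add: field_simps)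
next
  case (Suc m)
  define k C where kC: "k = gegenbauer_kernel l u" "C = (\<lambda>n. complex_of_real (gegenbauer l n x))"
  have 1: "2 * z * (of_nat m + 1 + of_real l) * k (Suc m)
     = (of_nat m + 1) * k m + (of_nat m + 1 + 2 * of_real l) * k (Suc (Suc m))"
    using gegenbauer_kernel_rec[OF assms, of "Suc m"] by (simp add: kC add_ac)
  have 2: "(of_nat m + 2) * C (Suc (Suc m))
    = 2 * (of_nat m + 1 + of_real l) * of_real x * C (Suc m) - (of_nat m + 2 * of_real l) * C m"
    using arg_cong[OF gegenbauer_rec[of m l x], of complex_of_real] by (simp add: kC del: gegenbauer.simps)
  define S where "S = (\<Sum>n\<le>m. (of_nat n + of_real l) * k n * C n)"
  have IH: "(z - of_real x) * S = 1 - ((of_nat m + 1) * k m * C (Suc m) - (of_nat m + 2 * of_real l) * k (Suc m) * C m) / 2"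
    using Suc.IH by (simp only: S_def kC)
  have half: "a = 1 - b / 2 \<longleftrightarrow> 2 * a = 2 - b" for a b :: complex
    by (auto simp: field_simps)
  have "2 * ((z - of_real x) * (S + (of_nat m + 1 + of_real l) * k (Suc m) * C (Suc m)))
    = 2 - ((of_nat m + 2) * k (Suc m) * C (Suc (Suc m)) - (of_nat m + 1 + 2 * of_real l) * k (Suc (Suc m)) * C (Suc m))"
  proof -
    have "2 * ((z - of_real x) * S) = 2 - ((of_nat m + 1) * k m * C (Suc m) - (of_nat m + 2 * of_real l) * k (Suc m) * C m)"
      by (rule iffD1[OF half IH])
    with 1 2 show ?thesis by algebra
  qed
  from iffD2[OF half this] have "(z - of_real x) * (S + (of_nat m + 1 + of_real l) * k (Suc m) * C (Suc m))
    = 1 - ((of_nat m + 2) * k (Suc m) * C (Suc (Suc m)) - (of_nat m + 1 + 2 * of_real l) * k (Suc (Suc m)) * C (Suc m)) / 2" .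
  then show ?case unfolding S_def kC by (simp add: add_ac del: gegenbauer.simps)
qed

lemma norm_gegenbauer_kernel_le:
  assumes l: "l > 1" and u: "cmod u = r" and r: "r > 1"
  shows "cmod (gegenbauer_kernel l u n) \<le> 2 * (1 + 1 / r\<^sup>2) powr (l - 1) * Beta (real n + 1) l / r ^ Suc n"
proof -
  have "cmod (euler_int l (1 / u\<^sup>2) n) \<le> (1 + cmod (1 / u\<^sup>2)) powr (l - 1) * Beta (real n + 1) l"
    using u r by (intro norm_euler_int_le l norm_inverse_power2_less_1) auto
  then show ?thesis unfolding gegenbauer_kernel_def using r
    by (simp add: norm_divide norm_mult norm_power u divide_simps)
qed

text \<open>The weight \<open>n + l\<close> of the expansion cancels the factor by which
  \<open>Gamma (n + l + 1)\<close> exceeds \<open>Gamma (n + l)\<close>.\<close>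

lemma add_mult_Beta:
  assumes "l > 0"
  shows "(real n + l) * Beta (real n + 1) l = fact n * Gamma l / Gamma (real n + l)"
proof -
  have "Gamma (real n + 1 + l) = (real n + l) * Gamma (real n + l)"
    using Gamma_plus1_pos[of "real n + l"] assms by (simp add: add_ac)
  moreover have "real n + l > 0" using assms by linarith
  ultimately show ?thesis by (simp add: Beta_def Gamma_fact add.commute)
qed

text \<open>Coarse, but used only where a quantity has to tend to 0.\<close>

lemma Beta_real_le_1:
  fixes a b :: real
  assumes "a \<ge> 1" "b \<ge> 1"
  shows "Beta a b \<le> 1"
proof -
  have "Beta a b = integral {0..1} (\<lambda>t. t powr (a - 1) * (1 - t) powr (b - 1))"
    using has_integral_Beta_real[of a b] assms by (simp add: integral_unique)
  also have "\<dots> \<le> integral {0..1} (\<lambda>t::real. 1)"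
    using has_integral_Beta_real[of a b] assms
    by (intro integral_le) (auto intro!: mult_le_one powr_le1)
  finally show ?thesis by simp
qed

section \<open>Bernstein ellipses\<close>

lemma inverse_of_real_mult_cis: "1 / (of_real r * cis \<theta>) = cis (- \<theta>) / of_real r"
proof -
  have "1 / (of_real r * cis \<theta>) = inverse (cis \<theta>) / of_real r"
    by (simp only: divide_inverse inverse_mult_distrib mult_1 mult.commute)
  then show ?thesis by simp
qed

text \<open>The differences to the foci are \<open>(u - 1)\<^sup>2 / (2 * u)\<close> and
  \<open>(u + 1)\<^sup>2 / (2 * u)\<close>, so the parallelogram law evaluates the sum of their
  moduli.\<close>

lemma Joukowski_focal_sum:
  assumes "cmod u = r" "r > 0"
  shows "cmod ((u + 1 / u) / 2 - 1) + cmod ((u + 1 / u) / 2 + 1) = r + 1 / r"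
proof -
  have "u \<noteq> 0" using assms by auto
  then have "(u + 1 / u) / 2 - 1 = (u - 1)\<^sup>2 / (2 * u)" "(u + 1 / u) / 2 + 1 = (u + 1)\<^sup>2 / (2 * u)"
    by (simp_all add: field_simps power2_eq_square)
  moreover have "(cmod (u - 1))\<^sup>2 + (cmod (u + 1))\<^sup>2 = 2 * r\<^sup>2 + 2"
    unfolding assms(1)[symmetric] cmod_power2 by (simp add: power2_eq_square algebra_simps)
  ultimately show ?thesis using assms
    by (simp add: norm_divide norm_power norm_mult add_divide_distrib[symmetric]) (simp add: field_simps power2_eq_square)
qed

text \<open>Triangle inequality from each focus through \<open>x\<close>; the distances from
  \<open>x\<close> to the two foci add up to 2.\<close>

lemma focal_sum_dist_ge:
  assumes "cmod (z - 1) + cmod (z + 1) = s" and x: "x \<in> {-1..1::real}"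
  shows "cmod (z - of_real x) \<ge> (s - 2) / 2"
proof -
  have "cmod (z - 1) \<le> cmod (z - of_real x) + cmod (of_real (x - 1))"
    using norm_triangle_ineq[of "z - of_real x" "of_real (x - 1)"] by simp
  moreover have "cmod (z + 1) \<le> cmod (z - of_real x) + cmod (of_real (x + 1))"
    using norm_triangle_ineq[of "z - of_real x" "of_real (x + 1)"] by simp
  ultimately show ?thesis using assms unfolding norm_of_real by auto
qed

text \<open>The focal sum is a convex function. Convexity gives access to the Cauchy formula for
  convex sets, whose contour may run along the boundary.\<close>

lemma convex_bernstein_region: "convex (bernstein_region r)"
proof -
  have le: "cmod (a *\<^sub>R y + b *\<^sub>R z - c) \<le> a * cmod (y - c) + b * cmod (z - c)"
    if "a \<ge> 0" "b \<ge> 0" "a + b = 1" for a b and y z c :: complex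
  proof -
    have "a *\<^sub>R y + b *\<^sub>R z - (a + b) *\<^sub>R c = a *\<^sub>R (y - c) + b *\<^sub>R (z - c)"
      by (simp add: algebra_simps)
    then show ?thesis using norm_triangle_ineq[of "a *\<^sub>R (y - c)" "b *\<^sub>R (z - c)"] that by simp
  qed
  show ?thesis
  proof (rule convexI)
    fix y z :: complex and a b :: real
    assume yz: "y \<in> bernstein_region r" "z \<in> bernstein_region r" and ab: "a \<ge> 0" "b \<ge> 0" "a + b = 1"
    have "cmod (a *\<^sub>R y + b *\<^sub>R z - 1) + cmod (a *\<^sub>R y + b *\<^sub>R z + 1)
      \<le> a * (cmod (y - 1) + cmod (y + 1)) + b * (cmod (z - 1) + cmod (z + 1))"
      using le[OF ab, of y z 1] le[OF ab, of y z "-1"] by (simp add: algebra_simps)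
    also have "\<dots> \<le> a * (r + 1 / r) + b * (r + 1 / r)"
      using yz ab unfolding bernstein_region_def by (intro add_mono[of "a * _"] mult_left_mono) auto
    also have "\<dots> = r + 1 / r" using ab(3) by (metis distrib_right mult_1)
    finally show "a *\<^sub>R y + b *\<^sub>R z \<in> bernstein_region r" by (simp add: bernstein_region_def)
  qed
qed

lemma add_inverse_gt_2:
  assumes "r > (1::real)"
  shows "r + 1 / r > 2"
proof -
  have "r + 1 / r - 2 = (r - 1)\<^sup>2 / r" using assms by (simp add: field_simps power2_eq_square)
  also have "\<dots> > 0" using assms by simp
  finally show ?thesis by simp
qed

lemma Icc_subset_interior_bernstein_region:
  assumes "r > 1" and x: "x \<in> {-1..1::real}"
  shows "of_real x \<in> interior (bernstein_region r)"
proof (rule interiorI)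
  show "open {z. cmod (z - 1) + cmod (z + 1) < r + 1 / r}"
    by (intro open_Collect_less continuous_intros)
  have "2 < r + 1 / r" using assms by (intro add_inverse_gt_2)
  moreover have "cmod (of_real x - 1) = 1 - x" "cmod (of_real x + 1) = x + 1"
    using x norm_of_real[of "x - 1", where 'a = complex] norm_of_real[of "x + 1", where 'a = complex] by auto
  ultimately show "complex_of_real x \<in> {z. cmod (z - 1) + cmod (z + 1) < r + 1 / r}"
    by simp
qed (auto simp: bernstein_region_def)

section \<open>Contour integration over the ellipse in the Joukowski parameter\<close>

lemma has_vector_derivative_circlepath_0:
  "(circlepath 0 r has_vector_derivative 2 * of_real pi * \<i> * circlepath 0 r t) (at t)"
  using has_vector_derivative_circlepath[of 0 r t UNIV] by (simp add: circlepath mult_ac)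

lemma has_vector_derivative_Joukowski_circlepath:
  assumes "r > 0"
  shows "((\<lambda>t. (circlepath 0 r t + 1 / circlepath 0 r t) / 2) has_vector_derivative
     of_real pi * \<i> * (circlepath 0 r t - 1 / circlepath 0 r t)) (at t)"
proof -
  have nz: "circlepath 0 r t \<noteq> 0" using assms by (simp add: circlepath)
  note 1 = has_vector_derivative_circlepath_0[of r t]
  have 2: "((\<lambda>u. (u + 1 / u) / 2) has_field_derivative (1 - 1 / (circlepath 0 r t)\<^sup>2) / 2) (at (circlepath 0 r t))"
    using nz by (auto intro!: derivative_eq_intros simp: power2_eq_square)
  have eq: "2 * of_real pi * \<i> * u * ((1 - 1 / u\<^sup>2) / 2) = of_real pi * \<i> * (u - 1 / u)" if "u \<noteq> 0" for u
    using that by (simp add: field_simps power2_eq_square)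
  show ?thesis
    using field_vector_diff_chain_at[OF 1 2] unfolding o_def eq[OF nz] .
qed

text \<open>Writing \<open>x = (v + 1 / v) / 2\<close> with \<open>cmod v = 1\<close>, the logarithmic derivative of
  \<open>(u + 1 / u) / 2 - x\<close> in \<open>u\<close> is \<open>1 / (u - v) + 1 / (u - 1 / v) - 1 / u\<close>.\<close>
lemma winding_number_bernstein:
  fixes x :: real
  assumes r: "r > 1" and x: "x \<in> {-1..1}"
  defines "g \<equiv> \<lambda>t. (circlepath 0 r t + 1 / circlepath 0 r t) / 2"
  assumes g: "valid_path g" "of_real x \<notin> path_image g"
  shows "winding_number g (of_real x) = 1"
proof -
  define v where "v = cis (arccos x)"
  define v' where "v' = cis (- arccos x)"
  have vv': "v * v' = 1" "v + v' = 2 * of_real x"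
    using x by (simp_all add: v_def v'_def cis_mult complex_eq_iff)
  have "((\<lambda>u. 1 / (u - w)) has_contour_integral 2 * of_real pi * \<i>) (circlepath 0 r)" if "cmod w < r" for w
    using Cauchy_integral_circlepath_simple[of "\<lambda>_. 1" 0 r w] that by simp
  \<comment> \<open>All three poles lie inside the circle, as \<open>v\<close> and \<open>v'\<close>
    have modulus \<open>1 < r\<close>; the residues are 1, 1 and -1.\<close>
  from this[of v] this[of v'] this[of 0]
  have "((\<lambda>u. 1 / (u - v) + 1 / (u - v') - 1 / (u - 0)) has_contour_integral
      2 * of_real pi * \<i> + 2 * of_real pi * \<i> - 2 * of_real pi * \<i>) (circlepath 0 r)"
    using r by (intro has_contour_integral_add has_contour_integral_diff) (auto simp: v_def v'_def)
  then have "((\<lambda>t. (1 / (circlepath 0 r t - v) + 1 / (circlepath 0 r t - v') - 1 / circlepath 0 r t)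
      * vector_derivative (circlepath 0 r) (at t)) has_integral 2 * of_real pi * \<i>) {0..1}"
    unfolding has_contour_integral by (simp add: mult_ac)
  also have "?this \<longleftrightarrow> ((\<lambda>t. 1 / (g t - of_real x) * vector_derivative g (at t)) has_integral 2 * of_real pi * \<i>) {0..1}"
  proof (rule has_integral_cong)
    fix t :: real assume "t \<in> {0..1}"
    define u where "u = circlepath 0 r t"
    have "cmod u = r" using r by (simp add: u_def circlepath norm_mult)
    then have nz: "u \<noteq> 0" "u - v \<noteq> 0" "u - v' \<noteq> 0" using r by (auto simp: v_def v'_def)
    have "vector_derivative g (at t) = of_real pi * \<i> * (u - 1 / u)"
      unfolding g_def u_def using r by (intro vector_derivative_at has_vector_derivative_Joukowski_circlepath) auto
    moreover have "vector_derivative (circlepath 0 r) (at t) = 2 * of_real pi * \<i> * u"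
      unfolding u_def by (rule vector_derivative_at[OF has_vector_derivative_circlepath_0])
    moreover have "g t - of_real x = (u - v) * (u - v') / (2 * u)"
    proof -
      have "(u - v) * (u - v') = u * u - u * (2 * of_real x) + 1"
        unfolding vv'(2)[symmetric] using vv'(1) by (simp add: algebra_simps)
      then show ?thesis using nz by (simp add: g_def u_def[symmetric] field_simps)
    qed
    moreover have "(1 / (u - v) + 1 / (u - v') - 1 / u) * (2 * of_real pi * \<i> * u)
      = 1 / ((u - v) * (u - v') / (2 * u)) * (of_real pi * \<i> * (u - 1 / u))"
    proof -
      have "(1 / (u - v) + 1 / (u - v') - 1 / u) = (u * u - v * v') / ((u - v) * (u - v') * u)"
        using nz by (simp add: divide_simps) (simp add: algebra_simps)
      then show ?thesis unfolding vv' using nz by (simp add: divide_simps)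
    qed
    ultimately show "(1 / (circlepath 0 r t - v) + 1 / (circlepath 0 r t - v') - 1 / circlepath 0 r t)
      * vector_derivative (circlepath 0 r) (at t) = 1 / (g t - of_real x) * vector_derivative g (at t)"
      by (simp only: u_def)
  qed
  finally have "((\<lambda>w. 1 / (w - of_real x)) has_contour_integral 2 * of_real pi * \<i>) g"
    unfolding has_contour_integral .
  from contour_integral_unique[OF this] show ?thesis
    using winding_number_valid_path[OF g] by simp
qed

text \<open>In the parameter \<open>t\<close> one has
  \<open>dz = pi * \<i> * (u - 1 / u) dt\<close>; dividing by \<open>2 * pi * \<i>\<close> leaves
  the factor \<open>(u - 1 / u) / 2\<close>, whose modulus \<open>bernstein_length_eq\<close>
  integrates.\<close>

lemma bernstein_Cauchy_formula:
  fixes x :: real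
  assumes r: "r > 1" and f: "f analytic_on bernstein_region r" and x: "x \<in> {-1..1}"
  defines "u \<equiv> \<lambda>t. of_real r * cis (2 * pi * t)"
  shows "((\<lambda>t. f ((u t + 1 / u t) / 2) * ((u t - 1 / u t) / 2) / ((u t + 1 / u t) / 2 - of_real x)) has_integral f (of_real x)) {0..1}"
proof -
  have u: "circlepath 0 r = u"
    by (simp add: fun_eq_iff u_def circlepath cis_conv_exp mult_ac)
  define g where "g = (\<lambda>t. (circlepath 0 r t + 1 / circlepath 0 r t) / 2)"
  have norm: "cmod (circlepath 0 r t) = r" for t using r by (simp add: u u_def norm_mult)
  have valid: "valid_path g"
  proof -
    have "valid_path ((\<lambda>u. (u + 1 / u) / 2) \<circ> circlepath 0 r)"
      using r by (intro valid_path_compose_holomorphic[where S = "- {0}"] holomorphic_intros) auto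
    then show ?thesis by (simp add: g_def o_def)
  qed
  have focal: "cmod (g t - 1) + cmod (g t + 1) = r + 1 / r" for t
    unfolding g_def using r by (intro Joukowski_focal_sum norm) auto
  have dist: "cmod (g t - of_real x) > 0" for t
    by (rule less_le_trans[OF _ focal_sum_dist_ge[OF focal x]]) (use add_inverse_gt_2[OF r] in simp)
  have image: "path_image g \<subseteq> bernstein_region r - {of_real x}"
    using dist focal by (auto simp: path_image_def bernstein_region_def)
  have "pathfinish g = pathstart g"
    by (simp add: g_def pathfinish_def pathstart_def u u_def)
  note Cauchy_integral_formula_convex_simple[OF convex_bernstein_region analytic_imp_holomorphic[OF f]
      Icc_subset_interior_bernstein_region[OF r x] valid image this]
  moreover have "winding_number g (of_real x) = 1"
    unfolding g_def using valid image by (intro winding_number_bernstein r x) (auto simp: g_def)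
  ultimately have "((\<lambda>w. f w / (w - of_real x)) has_contour_integral 2 * of_real pi * \<i> * f (of_real x)) g"
    by simp
  then have "((\<lambda>t. f (g t) / (g t - of_real x) * (of_real pi * \<i> * (u t - 1 / u t))) has_integral
      2 * of_real pi * \<i> * f (of_real x)) {0..1}"
    unfolding has_contour_integral
    using vector_derivative_at[OF has_vector_derivative_Joukowski_circlepath, of r] r by (simp add: g_def u)
  from has_integral_mult_right[OF this, of "1 / (2 * (of_real pi * \<i>))"]
  have "((\<lambda>t. 1 / (2 * (of_real pi * \<i>)) * (f (g t) / (g t - of_real x) * (of_real pi * \<i> * (u t - 1 / u t))))
     has_integral f (of_real x)) {0..1}" by simp
  moreover have "1 / (2 * p) * (a / b * (p * c)) = a * (c / 2) / b" if "p \<noteq> 0" for a b c p :: complex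
    using that by simp
  from this[of "of_real pi * \<i>"]
  have "1 / (2 * (of_real pi * \<i>)) * (a / b * (of_real pi * \<i> * c)) = a * (c / 2) / b" for a b c
    by auto
  ultimately show ?thesis by (simp only: g_def u)
qed

text \<open>The factor \<open>1 / (2 * pi)\<close> comes from \<open>\<theta> = 2 * pi * t\<close>;
  the integrand is that of \<open>bernstein_length\<close>.\<close>

lemma bernstein_length_eq:
  assumes r: "r > 0"
  defines "u \<equiv> \<lambda>t. of_real r * cis (2 * pi * t)"
  shows "((\<lambda>t. cmod ((u t - 1 / u t) / 2)) has_integral bernstein_length r / (2 * pi)) {0..1}"
proof -
  define h where "h = (\<lambda>\<theta>. cmod (of_real r * cis \<theta> - cis (- \<theta>) / of_real r) / 2)"
  have "continuous_on {0..2*pi} h"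
    unfolding h_def using r by (intro continuous_intros) auto
  then have "(h has_integral bernstein_length r) (cbox 0 (2 * pi))"
    unfolding bernstein_length_def h_def[symmetric] box_real
    by (intro integrable_integral integrable_continuous_real)
  from has_integral_affinity'[OF this, of "2 * pi" 0]
  have "((\<lambda>t. h (2 * pi * t)) has_integral (bernstein_length r /\<^sub>R (2 * pi) ^ DIM(real))) {0..1}"
    by (simp del: inverse_mult_distrib)
  also have "bernstein_length r /\<^sub>R (2 * pi) ^ DIM(real) = bernstein_length r / (2 * pi)"
    by (simp add: field_simps)
  finally have "((\<lambda>t. h (2 * pi * t)) has_integral bernstein_length r / (2 * pi)) {0..1}" .
  moreover have "h (2 * pi * t) = cmod ((u t - 1 / u t) / 2)" for t
    by (simp add: h_def u_def norm_divide inverse_of_real_mult_cis)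
  ultimately show ?thesis by simp
qed

section \<open>The expansion and its truncation error\<close>

text \<open>This is the part of the remainder bound that varies with the index. Consecutive
  quotients tend to \<open>1 / r < 1\<close>, so the ratio test applies without asymptotics of the
  Gamma function.\<close>

lemma tendsto_gegenbauer_at_1_geometric:
  assumes l: "l > 0" and r: "r > 1"
  shows "(\<lambda>n. (real n + 2 * l) * gegenbauer l n 1 / r ^ Suc n) \<longlonglongrightarrow> 0"
proof -
  define d where "d = (\<lambda>n. (real n + 2 * l) * gegenbauer l n 1 / r ^ Suc n)"
  have pos: "d n > 0" for n
    using l r by (auto simp: d_def gegenbauer_at_1 intro!: divide_pos_pos mult_pos_pos Gamma_real_pos add_nonneg_pos)
  have Suc: "d (Suc n) = (real n + 1 + 2 * l) / (real n + 1) / r * d n" for n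
  proof -
    have "gegenbauer l (Suc n) 1 = (real n + 2 * l) * gegenbauer l n 1 / (real n + 1)"
      using gegenbauer_Suc_at_1[of n l] by (simp add: field_simps del: gegenbauer.simps)
    then show ?thesis using r by (simp add: d_def divide_simps del: gegenbauer.simps)
  qed
  have lim: "(\<lambda>n. (real n + 1 + 2 * l) / (real n + 1) / r) \<longlonglongrightarrow> 1 / r"
  proof (rule tendsto_divide)
    show "(\<lambda>n. (real n + 1 + 2 * l) / (real n + 1)) \<longlonglongrightarrow> 1" by real_asymp
  qed (use r in auto)
  define c where "c = (1 + 1 / r) / 2"
  have c: "1 / r < c" "c < 1" using r by (auto simp: c_def field_simps)
  from order_tendstoD(2)[OF lim c(1)] obtain N where N: "\<And>n. n \<ge> N \<Longrightarrow> (real n + 1 + 2 * l) / (real n + 1) / r < c"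
    by (auto simp: eventually_sequentially)
  have "summable d"
  proof (rule summable_ratio_test[OF c(2), of N])
    fix n assume "n \<ge> N"
    from mult_right_mono[OF less_imp_le[OF N[OF this]], of "d n"] pos[of n]
    have "d (Suc n) \<le> c * d n" unfolding Suc by simp
    then show "norm (d (Suc n)) \<le> c * norm (d n)"
      using pos[of n] pos[of "Suc n"] by simp
  qed
  then show ?thesis unfolding d_def[symmetric] by (rule summable_LIMSEQ_zero)
qed

text \<open>After integration against the weight times \<open>C_n\<close>, orthogonality keeps only
  \<open>b n\<close> as soon as \<open>m\<close> is at least \<open>n\<close>, with an error of at
  most \<open>e m\<close> times a constant. Letting \<open>m\<close> grow forces equality.\<close>

lemma gegenbauer_coeff_eqI:
  fixes f :: "complex \<Rightarrow> complex"
  assumes l: "l > 1/2" and f: "continuous_on {-1..1} (\<lambda>x::real. f (of_real x))"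
  assumes le: "\<And>m x. x \<in> {-1..1} \<Longrightarrow> cmod (f (of_real x) - (\<Sum>n\<le>m. b n * of_real (gegenbauer l n x))) \<le> e m"
  assumes e: "e \<longlonglongrightarrow> 0"
  shows "gegenbauer_coeff l f n = b n"
proof -
  define w where "w = (\<lambda>x::real. (1 - x\<^sup>2) powr (l - 1/2))"
  have cw: "continuous_on {-1..1} w" unfolding w_def by (intro continuous_intros l)
  define B where "B = integral {-1..1} (\<lambda>x. \<bar>w x * gegenbauer l n x\<bar>)"
  define A where "A = integral {-1..1} (\<lambda>x. of_real (w x * gegenbauer l n x) * f (of_real x))"
  have h: "gegenbauer_h l n > 0" using l by (intro gegenbauer_h_pos) auto
  have bound: "cmod (A - b n * of_real (gegenbauer_h l n)) \<le> e m * B" if "m \<ge> n" for m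
  proof -
    define S where "S = (\<lambda>x. \<Sum>k\<le>m. b k * of_real (gegenbauer l k x))"
    have A: "((\<lambda>x. of_real (w x * gegenbauer l n x) * f (of_real x)) has_integral A) {-1..1}"
      unfolding A_def by (intro integrable_integral integrable_continuous_real continuous_intros cw f)
    have inner: "((\<lambda>x. w x * gegenbauer l n x * gegenbauer l k x) has_integral gegenbauer_inner l n k) {-1..1}" for k
      unfolding gegenbauer_inner_def w_def
      by (intro integrable_integral integrable_continuous_real continuous_intros l)
    have "((\<lambda>x. of_real (w x * gegenbauer l n x) * S x) has_integral (\<Sum>k\<le>m. b k * of_real (gegenbauer_inner l n k))) {-1..1}"
    proof -
      have "((\<lambda>x. \<Sum>k\<le>m. b k * of_real (w x * gegenbauer l n x * gegenbauer l k x)) has_integral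
          (\<Sum>k\<le>m. b k * of_real (gegenbauer_inner l n k))) {-1..1}"
        by (intro has_integral_sum has_integral_mult_right has_integral_of_real inner) auto
      then show ?thesis by (simp add: S_def sum_distrib_left mult_ac)
    qed
    moreover have "(\<Sum>k\<le>m. b k * of_real (gegenbauer_inner l n k)) = b n * of_real (gegenbauer_h l n)"
      using that by (simp add: gegenbauer_orthogonality[OF l] if_distrib if_distribR cong: if_cong)
    ultimately have "((\<lambda>x. of_real (w x * gegenbauer l n x) * f (of_real x) - of_real (w x * gegenbauer l n x) * S x)
        has_integral A - b n * of_real (gegenbauer_h l n)) {-1..1}"
      using has_integral_diff[OF A] by simp
    then have D: "((\<lambda>x. of_real (w x * gegenbauer l n x) * (f (of_real x) - S x))
        has_integral A - b n * of_real (gegenbauer_h l n)) {-1..1}"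
      by (simp only: right_diff_distrib)
    have "norm (integral {-1..1} (\<lambda>x. of_real (w x * gegenbauer l n x) * (f (of_real x) - S x)))
       \<le> integral {-1..1} (\<lambda>x. e m * \<bar>w x * gegenbauer l n x\<bar>)"
    proof (rule integral_norm_bound_integral)
      show "(\<lambda>x. e m * \<bar>w x * gegenbauer l n x\<bar>) integrable_on {-1..1}"
        by (intro integrable_continuous_real continuous_intros cw)
      show "norm (of_real (w x * gegenbauer l n x) * (f (of_real x) - S x)) \<le> e m * \<bar>w x * gegenbauer l n x\<bar>"
        if "x \<in> {-1..1}" for x
        using mult_left_mono[OF le[OF that, of m], of "\<bar>w x * gegenbauer l n x\<bar>"]
        by (simp add: norm_mult S_def abs_mult mult_ac)
    qed (use D in blast)
    then show ?thesis unfolding integral_unique[OF D] B_def by simp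
  qed
  have "(\<lambda>m. e m * B) \<longlonglongrightarrow> 0" using tendsto_mult_right[OF e, of B] by simp
  then have "cmod (A - b n * of_real (gegenbauer_h l n)) \<le> 0"
    by (rule LIMSEQ_le_const) (use bound in blast)
  then have "A = b n * of_real (gegenbauer_h l n)" by simp
  then show ?thesis using h by (simp add: gegenbauer_coeff_def A_def w_def)
qed

text \<open>Multiplying by \<open>1 - q\<close> makes the sum telescope. Finite sums suffice because
  the limit is taken later, in the error \<open>e m\<close>.\<close>

lemma sum_ratio_bound:
  fixes s :: "nat \<Rightarrow> real"
  assumes q: "0 \<le> q" "q < 1" and nonneg: "\<And>n. s n \<ge> 0"
    and ratio: "\<And>n. n \<ge> N \<Longrightarrow> s (Suc n) \<le> q * s n"
  shows "(\<Sum>n=N..<m. s n) \<le> s N / (1 - q)"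
proof (cases "N \<le> m")
  case True
  have "(\<Sum>n=N..<m. s n) * (1 - q) \<le> s N - s m"
    using True
  proof (induction m rule: dec_induct)
    case (step n)
    then show ?case using ratio[of n] by (simp add: algebra_simps)
  qed simp
  also have "\<dots> \<le> s N" using nonneg[of m] by simp
  finally show ?thesis using q by (simp add: pos_le_divide_eq)
qed (use q nonneg[of N] in simp)

text \<open>Dividing the telescoped identity by \<open>z - x\<close> leaves the boundary term
  \<open>T\<close>. Its two halves get the same majorant, since
  \<open>(m + 1) * C_(m+1) 1 = (m + 2 * l) * C_m 1\<close>.\<close>

lemma gegenbauer_kernel_remainder_le:
  fixes x :: real
  assumes l: "l > 1" and r: "r > 1" and u: "cmod u = r" and z: "z = (u + 1 / u) / 2" and x: "x \<in> {-1..1}"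
  shows "cmod (1 / (z - of_real x)
            - (\<Sum>n\<le>m. (of_nat n + of_real l) * gegenbauer_kernel l u n * of_real (gegenbauer l n x)))
         \<le> 4 * (1 + 1 / r\<^sup>2) powr (l - 1) * ((real m + 2 * l) * gegenbauer l m 1 / r ^ Suc m) / (r + 1 / r - 2)"
proof -
  define Q where "Q = (1 + 1 / r\<^sup>2) powr (l - 1)"
  define K where "K = gegenbauer_kernel l u"
  define C where "C = (\<lambda>n. gegenbauer l n x)"
  define S where "S = (\<Sum>n\<le>m. (of_nat n + of_real l) * K n * of_real (C n))"
  define T where "T = (of_nat m + 1) * K m * of_real (C (Suc m)) - (of_nat m + 2 * of_real l) * K (Suc m) * of_real (C m)"
  define c where "c = (real m + 2 * l) * gegenbauer l m 1"
  have Q0: "Q \<ge> 0" by (simp add: Q_def)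
  have K: "cmod (K k) \<le> 2 * Q / r ^ Suc k" for k
  proof -
    have "cmod (K k) \<le> 2 * Q * Beta (real k + 1) l / r ^ Suc k"
      unfolding K_def Q_def by (rule norm_gegenbauer_kernel_le[OF l u r])
    also have "\<dots> \<le> 2 * Q * 1 / r ^ Suc k"
      using l r Q0 by (intro divide_right_mono mult_left_mono Beta_real_le_1) auto
    finally show ?thesis by simp
  qed
  \<comment> \<open>One power of \<open>r\<close> is given away to match the bound for
    \<open>K m\<close>.\<close>
  have K1: "cmod (K (Suc m)) \<le> 2 * Q / r ^ Suc m"
    using r Q0 by (intro order.trans[OF K] divide_left_mono power_increasing) auto
  have C_le: "\<bar>C n\<bar> \<le> gegenbauer l n 1" for n unfolding C_def using l x by (intro abs_gegenbauer_le) auto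
  have c_Suc: "(real m + 1) * gegenbauer l (Suc m) 1 = c"
    using gegenbauer_Suc_at_1[of m l] by (simp add: c_def)
  have T: "cmod T \<le> 4 * Q / r ^ Suc m * c"
  proof -
    have "cmod (of_nat m + 1) = real m + 1" "cmod (of_nat m + 2 * of_real l) = real m + 2 * l"
      using norm_of_real[of "real m + 1", where 'a = complex] norm_of_real[of "real m + 2 * l", where 'a = complex] l by auto
    then have "cmod T \<le> (real m + 1) * cmod (K m) * \<bar>C (Suc m)\<bar> + (real m + 2 * l) * cmod (K (Suc m)) * \<bar>C m\<bar>"
      unfolding T_def by (intro order.trans[OF norm_triangle_ineq4]) (simp add: norm_mult)
    also have "\<dots> \<le> (real m + 1) * (2 * Q / r ^ Suc m) * gegenbauer l (Suc m) 1
        + (real m + 2 * l) * (2 * Q / r ^ Suc m) * gegenbauer l m 1"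
      using l r Q0 by (intro add_mono mult_mono K K1 C_le) auto
    also have "\<dots> = (2 * Q / r ^ Suc m) * ((real m + 1) * gegenbauer l (Suc m) 1) + (2 * Q / r ^ Suc m) * c"
      by (simp only: c_def mult_ac)
    also have "\<dots> = 4 * Q / r ^ Suc m * c" unfolding c_Suc by simp
    finally show ?thesis .
  qed
  define \<delta> where "\<delta> = r + 1 / r - 2"
  have \<delta>: "\<delta> > 0" using add_inverse_gt_2[OF r] by (simp add: \<delta>_def)
  have dist: "cmod (z - of_real x) \<ge> \<delta> / 2"
    unfolding \<delta>_def z using u r by (intro focal_sum_dist_ge[OF Joukowski_focal_sum x]) auto
  then have nz: "z - of_real x \<noteq> 0" using \<delta> by auto
  have "(z - of_real x) * S = 1 - T / 2"
    unfolding S_def T_def K_def C_def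
    by (intro gegenbauer_kernel_sum l) (use u r in simp, simp add: z)
  then have "S = (1 - T / 2) / (z - of_real x)" using nz by (metis nonzero_mult_div_cancel_left)
  then have "1 / (z - of_real x) - S = T / 2 / (z - of_real x)"
    by (simp add: diff_divide_distrib)
  then have "cmod (1 / (z - of_real x) - S) = cmod T / 2 / cmod (z - of_real x)"
    by (simp only: norm_divide norm_numeral)
  also have "\<dots> \<le> (4 * Q / r ^ Suc m * c) / 2 / (\<delta> / 2)"
    using T dist \<delta> order.trans[OF norm_ge_zero T] by (intro frac_le) auto
  also have "\<dots> = 4 * Q * (c / r ^ Suc m) / \<delta>" by simp
  finally show ?thesis unfolding S_def K_def C_def Q_def c_def \<delta>_def .
qed

text \<open>The \<open>b n\<close> arise as contour integrals and are not yet known to be the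
  Gegenbauer coefficients; the uniform error \<open>e\<close> has the form in which
  \<open>gegenbauer_coeff_eqI\<close> identifies them.\<close>

lemma bernstein_gegenbauer_expansion:
  fixes f :: "complex \<Rightarrow> complex"
  assumes r: "r > 1" and f: "f analytic_on bernstein_region r" and l: "l > 1"
  defines "A \<equiv> Sup ((\<lambda>z. cmod (f z)) ` bernstein_ellipse r) * bernstein_length r / pi"
  obtains b e where
    "\<And>n. cmod (b n) \<le> A * ((1 + 1 / r\<^sup>2) powr (l - 1) * (fact n * Gamma l / Gamma (real n + l)) / r ^ Suc n)"
    "\<And>m x. x \<in> {-1..1} \<Longrightarrow> cmod (f (of_real x) - (\<Sum>n\<le>m. b n * of_real (gegenbauer l n x))) \<le> e m"
    "e \<longlonglongrightarrow> 0" "A \<ge> 0"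
proof
  define u where "u = (\<lambda>t. of_real r * cis (2 * pi * t))"
  define g where "g = (\<lambda>t. (u t + 1 / u t) / 2)"
  define v where "v = (\<lambda>t. (u t - 1 / u t) / 2)"
  define D where "D = (\<lambda>t. f (g t) * v t)"
  define M where "M = Sup ((\<lambda>z. cmod (f z)) ` bernstein_ellipse r)"
  define Q where "Q = (1 + 1 / r\<^sup>2) powr (l - 1)"
  have u: "cmod (u t) = r" for t using r by (simp add: u_def norm_mult)
  have u0: "u t \<noteq> 0" for t using u[of t] r by auto
  have cu: "continuous_on S u" for S unfolding u_def by (intro continuous_intros)
  have cg: "continuous_on S g" for S unfolding g_def using u0 by (intro continuous_intros cu) auto
  have cv: "continuous_on S v" for S unfolding v_def using u0 by (intro continuous_intros cu) auto
  have region: "g t \<in> bernstein_region r" for t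
    using Joukowski_focal_sum[OF u, of t] r by (simp add: bernstein_region_def g_def)
  have cf: "continuous_on (bernstein_region r) f"
    by (intro holomorphic_on_imp_continuous_on analytic_imp_holomorphic f)
  have cfg: "continuous_on S (\<lambda>t. f (g t))" for S
    by (rule continuous_on_compose2[OF cf cg]) (use region in auto)
  have cD: "continuous_on S D" for S unfolding D_def by (intro continuous_intros cfg cv)
  have param: "bernstein_param r (2 * pi * t) = g t" for t
    by (simp add: bernstein_param_def g_def u_def inverse_of_real_mult_cis)
  have ellipse: "bernstein_ellipse r = g ` {0..1}"
  proof -
    have interval: "{0..2 * pi} = (\<lambda>t. 2 * pi * t) ` {0..1}"
      by (simp add: image_mult_atLeastAtMost)
    show ?thesis unfolding bernstein_ellipse_def interval image_image param ..
  qed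
  \<comment> \<open>\<open>Sup\<close> bounds its set only once boundedness is known, here from
    compactness of the parameter interval.\<close>
  have fM: "cmod (f (g t)) \<le> M" if "t \<in> {0..1}" for t
  proof -
    have "bdd_above ((\<lambda>z. cmod (f z)) ` bernstein_ellipse r)"
      unfolding ellipse image_image
      by (intro bounded_imp_bdd_above compact_imp_bounded compact_continuous_image continuous_intros cfg) auto
    then show ?thesis unfolding M_def by (intro cSup_upper) (use that in \<open>auto simp: ellipse\<close>)
  qed
  have "M \<ge> 0" by (rule order.trans[OF norm_ge_zero fM[of 0]]) simp
  have len: "((\<lambda>t. cmod (v t)) has_integral bernstein_length r / (2 * pi)) {0..1}"
    using bernstein_length_eq[of r] r by (simp add: v_def u_def)
  then have "bernstein_length r / (2 * pi) \<ge> 0" by (rule has_integral_nonneg) auto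
  moreover have A2: "A / 2 = M * (bernstein_length r / (2 * pi))" by (simp add: A_def M_def)
  ultimately show "A \<ge> 0" using \<open>M \<ge> 0\<close> mult_nonneg_nonneg by fastforce
  \<comment> \<open>One estimate serves both claims: \<open>\<phi>\<close> becomes the coefficient
    kernel \<open>\<kappa> n\<close> and then the remainder of the kernel expansion. In the first
    case the half in \<open>A / 2\<close> cancels against the factor 2 of
    \<open>norm_gegenbauer_kernel_le\<close>.\<close>
  have bound: "cmod I \<le> A / 2 * c"
    if I: "((\<lambda>t. D t * \<phi> t) has_integral I) {0..1}" and \<phi>: "\<And>t. t \<in> {0..1} \<Longrightarrow> cmod (\<phi> t) \<le> c" for I \<phi> c
  proof -
    have i: "((\<lambda>t. M * c * cmod (v t)) has_integral M * c * (bernstein_length r / (2 * pi))) {0..1}"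
      by (intro has_integral_mult_right len)
    have "norm (integral {0..1} (\<lambda>t. D t * \<phi> t)) \<le> integral {0..1} (\<lambda>t. M * c * cmod (v t))"
    proof (rule integral_norm_bound_integral)
      fix t :: real assume t: "t \<in> {0..1}"
      have "cmod (D t * \<phi> t) = cmod (f (g t)) * cmod (\<phi> t) * cmod (v t)" by (simp add: D_def norm_mult)
      also have "\<dots> \<le> M * c * cmod (v t)"
        using fM[OF t] \<phi>[OF t] \<open>M \<ge> 0\<close> by (intro mult_right_mono mult_mono) auto
      finally show "norm (D t * \<phi> t) \<le> M * c * cmod (v t)" .
    qed (use I i in blast)+
    then show ?thesis unfolding integral_unique[OF I] integral_unique[OF i] A2 by (simp add: mult_ac)
  qed
  define \<kappa> where "\<kappa> = (\<lambda>n t. (of_nat n + of_real l) * gegenbauer_kernel l (u t) n)"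
  have c\<kappa>: "continuous_on S (\<kappa> n)" for S n
  proof -
    have "continuous_on S (\<lambda>t. gegenbauer_kernel l (u t) n)"
      by (rule continuous_on_compose2[OF continuous_on_gegenbauer_kernel[OF l] cu]) (use u r in auto)
    then show ?thesis unfolding \<kappa>_def by (intro continuous_intros)
  qed
  define b where "b = (\<lambda>n. integral {0..1} (\<lambda>t. D t * \<kappa> n t))"
  have b: "((\<lambda>t. D t * \<kappa> n t) has_integral b n) {0..1}" for n
    unfolding b_def by (intro integrable_integral integrable_continuous_real continuous_intros cD c\<kappa>)
  define e where "e = (\<lambda>m. A / 2 * (4 * Q * ((real m + 2 * l) * gegenbauer l m 1 / r ^ Suc m) / (r + 1 / r - 2)))"
  show "cmod (b n) \<le> A * (Q * (fact n * Gamma l / Gamma (real n + l)) / r ^ Suc n)" for n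
  proof -
    have "cmod (b n) \<le> A / 2 * ((real n + l) * (2 * Q * Beta (real n + 1) l / r ^ Suc n))"
    proof (rule bound[OF b])
      fix t
      have "cmod (of_nat n + of_real l) = real n + l"
        using norm_of_real[of "real n + l", where 'a = complex] l by auto
      then show "cmod (\<kappa> n t) \<le> (real n + l) * (2 * Q * Beta (real n + 1) l / r ^ Suc n)"
        unfolding \<kappa>_def Q_def norm_mult
        using norm_gegenbauer_kernel_le[OF l u[of t] r, of n] l by (intro mult_mono) auto
    qed
    also have "\<dots> = A * (Q * ((real n + l) * Beta (real n + 1) l) / r ^ Suc n)" by simp
    also have "(real n + l) * Beta (real n + 1) l = fact n * Gamma l / Gamma (real n + l)"
      using l by (intro add_mult_Beta) auto
    finally show ?thesis .
  qed
  show "cmod (f (of_real x) - (\<Sum>n\<le>m. b n * of_real (gegenbauer l n x))) \<le> e m" if x: "x \<in> {-1..1}" for m x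
  proof -
    define S where "S = (\<lambda>t. \<Sum>n\<le>m. \<kappa> n t * of_real (gegenbauer l n x))"
    have "((\<lambda>t. \<Sum>n\<le>m. D t * \<kappa> n t * of_real (gegenbauer l n x)) has_integral
        (\<Sum>n\<le>m. b n * of_real (gegenbauer l n x))) {0..1}"
      by (intro has_integral_sum has_integral_mult_left b) auto
    moreover have "((\<lambda>t. D t / (g t - of_real x)) has_integral f (of_real x)) {0..1}"
      using bernstein_Cauchy_formula[OF r f x] by (simp add: D_def g_def v_def u_def)
    ultimately have "((\<lambda>t. D t / (g t - of_real x) - (\<Sum>n\<le>m. D t * \<kappa> n t * of_real (gegenbauer l n x)))
        has_integral f (of_real x) - (\<Sum>n\<le>m. b n * of_real (gegenbauer l n x))) {0..1}"
      by (intro has_integral_diff)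
    then have "((\<lambda>t. D t * (1 / (g t - of_real x) - S t))
        has_integral f (of_real x) - (\<Sum>n\<le>m. b n * of_real (gegenbauer l n x))) {0..1}"
      by (simp add: S_def right_diff_distrib sum_distrib_left mult.assoc)
    then show ?thesis unfolding e_def
    proof (rule bound)
      show "cmod (1 / (g t - of_real x) - S t)
        \<le> 4 * Q * ((real m + 2 * l) * gegenbauer l m 1 / r ^ Suc m) / (r + 1 / r - 2)" for t
        unfolding S_def \<kappa>_def Q_def by (rule gegenbauer_kernel_remainder_le[OF l r u _ x]) (simp add: g_def)
    qed
  qed
  have "(\<lambda>m. A / 2 * (4 * Q * ((real m + 2 * l) * gegenbauer l m 1 / r ^ Suc m) / (r + 1 / r - 2)))
     \<longlonglongrightarrow> A / 2 * (4 * Q * 0 / (r + 1 / r - 2))"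
    using l add_inverse_gt_2[OF r] by (intro tendsto_intros tendsto_gegenbauer_at_1_geometric r) auto
  then show "e \<longlonglongrightarrow> 0" by (simp add: e_def del: power_Suc)
qed

theorem theorem4p6:
  fixes \<rho> lam :: real and f :: "complex \<Rightarrow> complex" and N :: nat
  assumes "\<rho> > 1"
    and "f analytic_on bernstein_region \<rho>"
    and "lam > 1"
    and "\<rho> > (real N + 2 * lam) * (real N + lam + 1) / ((real N + lam) * (real N + 1))"
  shows "\<forall>x \<in> {-1..1::real}.
    cmod (f (complex_of_real x) - gegenbauer_partial lam f N x)
      \<le> Gamma lam * Gamma (real N + 2 * lam) / (Gamma (2 * lam) * Gamma (real N + lam))
         * (1 + 1 / \<rho>\<^sup>2) powr (lam - 1)
         * ((Sup ((\<lambda>z. cmod (f z)) ` bernstein_ellipse \<rho>) * bernstein_length \<rho> / pi)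
            * ((real N + lam) * (real N + 1)
               / (\<rho> * (real N + lam) * (real N + 1) - (real N + 2 * lam) * (real N + lam + 1))))
         / \<rho> ^ N"
proof
  fix x :: real assume x: "x \<in> {-1..1}"
  define A where "A = Sup ((\<lambda>z. cmod (f z)) ` bernstein_ellipse \<rho>) * bernstein_length \<rho> / pi"
  define Q where "Q = (1 + 1 / \<rho>\<^sup>2) powr (lam - 1)"
  have l: "lam > 0" "lam > 1/2" using assms(3) by auto
  obtain b e where
    b: "\<And>n. cmod (b n) \<le> A * (Q * (fact n * Gamma lam / Gamma (real n + lam)) / \<rho> ^ Suc n)" and
    e: "\<And>m x. x \<in> {-1..1} \<Longrightarrow> cmod (f (of_real x) - (\<Sum>n\<le>m. b n * of_real (gegenbauer lam n x))) \<le> e m" and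
    e0: "e \<longlonglongrightarrow> 0" and A: "A \<ge> 0"
    by (rule bernstein_gegenbauer_expansion[OF assms(1-3), folded A_def Q_def]) (rule that; assumption)
  have "continuous_on {-1..1} (\<lambda>x::real. f (of_real x))"
  proof -
    have "continuous_on (bernstein_region \<rho>) f"
      by (intro holomorphic_on_imp_continuous_on analytic_imp_holomorphic assms)
    moreover have "continuous_on {-1..1} complex_of_real" by (intro continuous_intros)
    moreover have "complex_of_real ` {-1..1} \<subseteq> bernstein_region \<rho>"
      using Icc_subset_interior_bernstein_region[OF assms(1)] interior_subset by blast
    ultimately show ?thesis
      by (rule continuous_on_compose2)
  qed
  from gegenbauer_coeff_eqI[OF l(2) this e e0] have coeff: "gegenbauer_coeff lam f n = b n" for n .

  \<comment> \<open>Bounds the ratio of consecutive term bounds from index \<open>N\<close> on; the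
    hypothesis on \<open>\<rho>\<close> says exactly \<open>q < 1\<close>.\<close>
  define q where "q = (real N + 2 * lam) * (real N + lam + 1) / ((real N + lam) * (real N + 1)) / \<rho>"
  have q: "0 \<le> q" "q < 1" using assms(1,3,4) by (auto simp: q_def divide_less_eq mult.commute)
  define B where "B = A * Q * Gamma lam / Gamma (2 * lam)"
  have B: "B \<ge> 0" unfolding B_def Q_def using A l by (auto intro!: divide_nonneg_nonneg mult_nonneg_nonneg Gamma_real_nonneg)
  define s where "s = (\<lambda>n. Gamma (real n + 2 * lam) / Gamma (real n + lam) / \<rho> ^ Suc n)"
  have s0: "s n \<ge> 0" for n
    unfolding s_def using assms(1) l by (auto intro!: divide_nonneg_nonneg Gamma_real_nonneg)
  have s_Suc: "s (Suc n) \<le> q * s n" if "n \<ge> N" for n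
  proof -
    have pos: "real n + lam > 0" "real N + lam > 0" using l by auto
    have "Gamma (real (Suc n) + 2 * lam) = (real n + 2 * lam) * Gamma (real n + 2 * lam)"
      "Gamma (real (Suc n) + lam) = (real n + lam) * Gamma (real n + lam)"
      using Gamma_plus1_pos[of "real n + 2 * lam"] Gamma_plus1_pos[of "real n + lam"] l by (simp_all add: add_ac)
    then have "s (Suc n) = (real n + 2 * lam) / (real n + lam) / \<rho> * s n"
      by (simp add: s_def)
    \<comment> \<open>The quotient is \<open>1 + lam / (n + lam)\<close>, which decreases in
      \<open>n\<close>; the factor 1 on the right is then enlarged to
      \<open>(N + lam + 1) / (N + 1)\<close> to reach \<open>q\<close>.\<close>
    also have "(real n + 2 * lam) / (real n + lam) \<le> (real N + 2 * lam) / (real N + lam) * 1"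
    proof -
      have "lam * real N \<le> lam * real n" using that l by (intro mult_left_mono) auto
      then show ?thesis using pos by (simp add: divide_simps algebra_simps)
    qed
    also have "\<dots> \<le> (real N + 2 * lam) / (real N + lam) * ((real N + lam + 1) / (real N + 1))"
      using l by (intro mult_left_mono) (auto simp: divide_simps)
    also have "\<dots> / \<rho> * s n = q * s n" by (simp add: q_def)
    finally show ?thesis using assms(1) s0 by (simp add: mult_right_mono divide_right_mono)
  qed
  have term_le: "cmod (b n * of_real (gegenbauer lam n x)) \<le> B * s n" for n
  proof -
    have "cmod (b n * of_real (gegenbauer lam n x)) = cmod (b n) * \<bar>gegenbauer lam n x\<bar>"
      by (simp add: norm_mult)
    also have "\<dots> \<le> A * (Q * (fact n * Gamma lam / Gamma (real n + lam)) / \<rho> ^ Suc n)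
        * (Gamma (real n + 2 * lam) / (fact n * Gamma (2 * lam)))"
      using b[of n] abs_gegenbauer_le[OF l(1) x, of n] order.trans[OF norm_ge_zero b[of n]]
      unfolding gegenbauer_at_1[OF l(1)] by (intro mult_mono) auto
    also have "\<dots> = B * s n" by (simp add: B_def s_def mult_ac)
    finally show ?thesis .
  qed
  have "cmod (f (of_real x) - gegenbauer_partial lam f N x) \<le> e m + B * (s N / (1 - q))" if "m \<ge> N" for m
  proof -
    let ?t = "\<lambda>n. b n * complex_of_real (gegenbauer lam n x)"
    have split: "(\<Sum>n\<le>m. ?t n) = gegenbauer_partial lam f N x + (\<Sum>n=N..<Suc m. ?t n)"
      using that unfolding gegenbauer_partial_def coeff lessThan_Suc_atMost[symmetric]
      by (simp add: sum.atLeastLessThan_concat lessThan_atLeast0 del: sum.lessThan_Suc sum.op_ivl_Suc)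
    have "f (of_real x) - gegenbauer_partial lam f N x = (f (of_real x) - (\<Sum>n\<le>m. ?t n)) + (\<Sum>n=N..<Suc m. ?t n)"
      unfolding split by simp
    also have "cmod \<dots> \<le> e m + (\<Sum>n=N..<Suc m. B * s n)"
      by (intro norm_triangle_le add_mono e x sum_norm_le term_le)
    also have "(\<Sum>n=N..<Suc m. B * s n) \<le> B * (s N / (1 - q))"
      unfolding sum_distrib_left[symmetric] by (intro mult_left_mono sum_ratio_bound q s0 s_Suc B)
    finally show ?thesis by simp
  qed
  \<comment> \<open>The left side of the estimate does not depend on \<open>m\<close>, so the
    expansion error drops out in the limit.\<close>
  moreover have "(\<lambda>m. e m + B * (s N / (1 - q))) \<longlonglongrightarrow> 0 + B * (s N / (1 - q))"
    by (intro tendsto_intros e0)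
  ultimately have "cmod (f (of_real x) - gegenbauer_partial lam f N x) \<le> B * (s N / (1 - q))"
    by (intro LIMSEQ_le_const[where X = "\<lambda>m. e m + B * (s N / (1 - q))"]) auto
  also have "\<dots> = Gamma lam * Gamma (real N + 2 * lam) / (Gamma (2 * lam) * Gamma (real N + lam)) * Q
      * (A * (1 / (\<rho> * (1 - q)))) / \<rho> ^ N"
    by (simp add: B_def s_def mult_ac)
  \<comment> \<open>The \<open>\<rho>\<close> next to \<open>1 - q\<close> is the one by which
    \<open>\<rho> ^ Suc N\<close> in \<open>s N\<close> exceeds \<open>\<rho> ^ N\<close>.\<close>
  also have "1 / (\<rho> * (1 - q)) = (real N + lam) * (real N + 1)
      / (\<rho> * (real N + lam) * (real N + 1) - (real N + 2 * lam) * (real N + lam + 1))"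
  proof -
    define c d where "c = (real N + lam) * (real N + 1)" "d = (real N + 2 * lam) * (real N + lam + 1)"
    note cd = this
    have "c > 0" using l by (simp add: cd add_nonneg_pos)
    moreover have "q = d / c / \<rho>" by (simp only: q_def cd)
    ultimately have "\<rho> * (1 - q) = (\<rho> * c - d) / c"
      using assms(1) by (simp add: field_simps)
    then show ?thesis by (simp add: cd mult.assoc)
  qed
  finally show "cmod (f (complex_of_real x) - gegenbauer_partial lam f N x)
      \<le> Gamma lam * Gamma (real N + 2 * lam) / (Gamma (2 * lam) * Gamma (real N + lam))
         * (1 + 1 / \<rho>\<^sup>2) powr (lam - 1)
         * ((Sup ((\<lambda>z. cmod (f z)) ` bernstein_ellipse \<rho>) * bernstein_length \<rho> / pi)
            * ((real N + lam) * (real N + 1)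
               / (\<rho> * (real N + lam) * (real N + 1) - (real N + 2 * lam) * (real N + lam + 1))))
         / \<rho> ^ N"
    unfolding A_def Q_def .
qed

end
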